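(* Let $(b,c)$ be a locally finite and connected graph over a countable set $X$, with a cocompact action of a nilpotent group $G$ such that $H_{b,c}$ is $G$-invariant, and fix $x_0\in X$. For $\lambda\in\mathbb{R}$ let $\mathcal{M}_\lambda$ be the set of multiplicative functions in $\mathcal{K}_\lambda$, and for $I\subseteq\mathbb{R}$ let $\mathcal{M}_I=\bigcup_{\lambda\in I}\mathcal{M}_\lambda$, all with the topology of pointwise convergence. Then there exist $\lambda_0\in\mathbb{R}$ and $d\in\mathbb{N}_0$ such that: (a) $\mathcal{M}_\lambda=\emptyset$ for $\lambda>\lambda_0$; (b) $\mathcal{M}_{\lambda_0}$ consists of exactly one point; (c) for $\lambda<\lambda_0$, $\mathcal{M}_\lambda$ is homeomorphic to a $(d-1)$-sphere (empty if $d=0$); (d) for every $\lambda\in[-\infty,\lambda_0)$, $\mathcal{M}_{(\lambda,\lambda_0]}$ is homeomorphic to an open $d$-ball.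
   Context: $X$ is countable; a graph is $(b,c)$ with $b:X\times X\to[0,\infty)$, $c:X\to\mathbb{R}$, $\sum_y b(x,y)<\infty$ for all $x$ ($b$ need not be symmetric); locally finite: each $x$ has finitely many $y$ with $b(x,y)>0$; connected: any two points are joined by a finite sequence $y_1,\dots,y_n$ with $b(y_i,y_{i+1})>0$. $H_{b,c}f(x)=\sum_y b(x,y)(f(x)-f(y))+c(x)f(x)$ on $\mathrm{Dom}(H)=\{f:\sum_y b(x,y)|f(y)|<\infty\ \forall x\}$. For $\lambda\in\mathbb{R}$, $f$ is $\lambda$-harmonic if $f\in\mathrm{Dom}(H)$ and $(H_{b,c}-\lambda)f=0$, i.e. harmonic for the graph $(b,c-\lambda)$. $\mathcal{K}_\lambda$ is the closure in $C(X)$ (pointwise convergence) of $\{f\ge0,\ f\not\equiv0,\ \lambda\text{-harmonic},\ f(x_0)=1\}$. For $G$ acting on $X$, $T_gf(x)=f(g^{-1}x)$; cocompact: $GV=X$ for some finite $V$; $H$ is $G$-invariant if $T_g(\mathrm{Dom}H)\subseteq\mathrm{Dom}H$ and $HT_g=T_gH$ for all $g$; $f$ is multiplicative if $T_gf=\gamma(g^{-1})f$ for all $g\in G$ for some homomorphism $\gamma:G\to(0,\infty)$. *)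

theory Defs
  imports "HOL-Analysis.Analysis" "HOL-Algebra.Group_Action" "HOL-Algebra.Generated_Groups"
begin

definition graph :: "('x \<Rightarrow> 'x \<Rightarrow> real) \<Rightarrow> bool" where
  "graph b \<longleftrightarrow> (\<forall>x y. 0 \<le> b x y) \<and> (\<forall>x. (b x) summable_on UNIV)"

definition locally_finite :: "('x \<Rightarrow> 'x \<Rightarrow> real) \<Rightarrow> bool" where
  "locally_finite b \<longleftrightarrow> (\<forall>x. finite {y. b x y > 0})"

definition connected_graph :: "('x \<Rightarrow> 'x \<Rightarrow> real) \<Rightarrow> bool" where
  "connected_graph b \<longleftrightarrow> (\<forall>x y. (\<lambda>u v. b u v > 0)\<^sup>*\<^sup>* x y)"

definition domH :: "('x \<Rightarrow> 'x \<Rightarrow> real) \<Rightarrow> ('x \<Rightarrow> real) set" where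
  "domH b = {f. \<forall>x. (\<lambda>y. b x y * \<bar>f y\<bar>) summable_on UNIV}"

definition Hop :: "('x \<Rightarrow> 'x \<Rightarrow> real) \<Rightarrow> ('x \<Rightarrow> real) \<Rightarrow> ('x \<Rightarrow> real) \<Rightarrow> ('x \<Rightarrow> real)" where
  "Hop b c f = (\<lambda>x. (\<Sum>\<^sub>\<infinity>y. b x y * (f x - f y)) + c x * f x)"

definition harmonic_at :: "('x \<Rightarrow> 'x \<Rightarrow> real) \<Rightarrow> ('x \<Rightarrow> real) \<Rightarrow> real \<Rightarrow> ('x \<Rightarrow> real) \<Rightarrow> bool" where
  "harmonic_at b c lam f \<longleftrightarrow> f \<in> domH b \<and> (\<forall>x. Hop b c f x - lam * f x = 0)"

text \<open>K_lambda: closure (topology of pointwise convergence = product topology on 'x => real)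
  of the normalized positive lambda-harmonic functions.\<close>
definition Kset :: "('x \<Rightarrow> 'x \<Rightarrow> real) \<Rightarrow> ('x \<Rightarrow> real) \<Rightarrow> 'x \<Rightarrow> real \<Rightarrow> ('x \<Rightarrow> real) set" where
  "Kset b c x0 lam = closure {f. (\<forall>x. 0 \<le> f x) \<and> f \<noteq> (\<lambda>_. 0) \<and> harmonic_at b c lam f \<and> f x0 = 1}"

definition Tg :: "('g \<Rightarrow> 'x \<Rightarrow> 'x) \<Rightarrow> ('g, 'm) monoid_scheme \<Rightarrow> 'g \<Rightarrow> ('x \<Rightarrow> real) \<Rightarrow> ('x \<Rightarrow> real)" where
  "Tg \<phi> G g f = (\<lambda>x. f (\<phi> (inv\<^bsub>G\<^esub> g) x))"

definition cocompact :: "('g, 'm) monoid_scheme \<Rightarrow> ('g \<Rightarrow> 'x \<Rightarrow> 'x) \<Rightarrow> bool" where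
  "cocompact G \<phi> \<longleftrightarrow> (\<exists>V. finite V \<and> (\<Union>g\<in>carrier G. \<phi> g ` V) = UNIV)"

definition H_invariant :: "('g, 'm) monoid_scheme \<Rightarrow> ('g \<Rightarrow> 'x \<Rightarrow> 'x) \<Rightarrow> ('x \<Rightarrow> 'x \<Rightarrow> real) \<Rightarrow> ('x \<Rightarrow> real) \<Rightarrow> bool" where
  "H_invariant G \<phi> b c \<longleftrightarrow> (\<forall>g\<in>carrier G. Tg \<phi> G g ` domH b \<subseteq> domH b \<and>
      (\<forall>f\<in>domH b. Hop b c (Tg \<phi> G g f) = Tg \<phi> G g (Hop b c f)))"

definition multiplicative :: "('g, 'm) monoid_scheme \<Rightarrow> ('g \<Rightarrow> 'x \<Rightarrow> 'x) \<Rightarrow> ('x \<Rightarrow> real) \<Rightarrow> bool" where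
  "multiplicative G \<phi> f \<longleftrightarrow> (\<exists>\<gamma> :: 'g \<Rightarrow> real.
      (\<forall>g\<in>carrier G. 0 < \<gamma> g) \<and>
      (\<forall>g\<in>carrier G. \<forall>h\<in>carrier G. \<gamma> (g \<otimes>\<^bsub>G\<^esub> h) = \<gamma> g * \<gamma> h) \<and>
      (\<forall>g\<in>carrier G. Tg \<phi> G g f = (\<lambda>x. \<gamma> (inv\<^bsub>G\<^esub> g) * f x)))"

fun lower_central :: "('g, 'm) monoid_scheme \<Rightarrow> nat \<Rightarrow> 'g set" where
  "lower_central G 0 = carrier G"
| "lower_central G (Suc n) = generate G
     {x \<otimes>\<^bsub>G\<^esub> y \<otimes>\<^bsub>G\<^esub> inv\<^bsub>G\<^esub> x \<otimes>\<^bsub>G\<^esub> inv\<^bsub>G\<^esub> y | x y. x \<in> carrier G \<and> y \<in> lower_central G n}"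

definition nilpotent_group :: "('g, 'm) monoid_scheme \<Rightarrow> bool" where
  "nilpotent_group G \<longleftrightarrow> group G \<and> (\<exists>n. lower_central G n = {\<one>\<^bsub>G\<^esub>})"

definition Mset :: "('g, 'm) monoid_scheme \<Rightarrow> ('g \<Rightarrow> 'x \<Rightarrow> 'x) \<Rightarrow> ('x \<Rightarrow> 'x \<Rightarrow> real) \<Rightarrow> ('x \<Rightarrow> real) \<Rightarrow> 'x \<Rightarrow> real set \<Rightarrow> ('x \<Rightarrow> real) set" where
  "Mset G \<phi> b c x0 I = (\<Union>lam\<in>I. {f \<in> Kset b c x0 lam. multiplicative G \<phi> f})"

section \<open>Model spaces: unit (d-1)-sphere and open unit d-ball in R^d,
  realised inside nat => real (product topology) with coordinates >= d equal to 0;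
  on such a subspace the product topology agrees with the Euclidean topology of R^d.\<close>

definition sphere_d :: "nat \<Rightarrow> (nat \<Rightarrow> real) set" where
  "sphere_d d = {v. (\<forall>i\<ge>d. v i = 0) \<and> (\<Sum>i<d. (v i)\<^sup>2) = 1}"

definition ball_d :: "nat \<Rightarrow> (nat \<Rightarrow> real) set" where
  "ball_d d = {v. (\<forall>i\<ge>d. v i = 0) \<and> (\<Sum>i<d. (v i)\<^sup>2) < 1}"

end

theory Submission
  imports Defs
begin

text \<open>
  Modulo the cocompact action, the operator \<open>H\<close> restricted to the functions that transform by a fixed
  character \<open>exp \<circ> \<alpha>\<close> of \<open>G\<close> is a finite irreducible matrix with nonpositive off-diagonal
  entries, so Perron-Frobenius yields exactly one normalized positive eigenfunction \<open>f\<^sub>\<alpha>\<close>, with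
  eigenvalue \<open>\<lambda>(\<alpha>)\<close>. The admissible \<open>\<alpha>\<close> form a vector space of finite dimension \<open>d\<close>. By the
  AM-GM inequality applied to the geometric mean of two eigenfunctions, \<open>\<lambda>\<close> is strictly concave, and
  Harnack's inequality makes its superlevel sets compact. Hence \<open>\<lambda>\<close> has a unique maximum and is
  strictly decreasing to \<open>-\<infinity>\<close> along each ray from it, and radial projection identifies its level
  sets with spheres and its strict superlevel sets with open balls.
\<close>

section \<open>Superlevel sets of a proper strictly concave function\<close>

text \<open>The matrix is never formed. The eigenvalue of a character appears as the largest \<mu>
  that admits a positive equivariant supersolution (the Collatz-Wielandt characterization);
  existence and uniqueness rest on minimum principles, which work for nonsymmetric \<open>b\<close>.
  Because \<open>f x0 = 1\<close>, a multiplicative eigenfunction determines its character, g to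
  \<open>f (\<phi> g x0)\<close>, and its eigenvalue \<open>H f x0\<close>. Every set in the theorem
  is therefore a slice of the single set \<open>eigenfuns\<close> by the function f to
  \<open>H f x0\<close>. Two obstacles shape the setup. The group element carrying an orbit
  representative to x is unique only up to a stabilizer, so the characters that occur are trivial on
  stabilizers. Strict superlevel sets need not be compact, so the inverse of the radial map onto the
  ball is shown continuous inside compact superlevel sets.\<close>

definition Enorm :: "nat \<Rightarrow> (nat \<Rightarrow> real) \<Rightarrow> real" where
  "Enorm d v = sqrt (\<Sum>i<d. (v i)\<^sup>2)"

lemma Enorm_nonneg: "0 \<le> Enorm d v"
  by (simp add: Enorm_def sum_nonneg)

lemma Enorm_scale: "Enorm d (\<lambda>i. t * v i) = \<bar>t\<bar> * Enorm d v"
  by (simp add: Enorm_def power_mult_distrib sum_distrib_left [symmetric] real_sqrt_mult)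

lemma Enorm_eq_0: "Enorm d v = 0 \<longleftrightarrow> (\<forall>i<d. v i = 0)"
  by (auto simp: Enorm_def sum_nonneg_eq_0_iff)

lemma abs_le_Enorm: "i < d \<Longrightarrow> \<bar>v i\<bar> \<le> Enorm d v"
proof -
  assume "i < d"
  then have "(v i)\<^sup>2 \<le> (\<Sum>i<d. (v i)\<^sup>2)"
    by (intro member_le_sum) auto
  then have "sqrt ((v i)\<^sup>2) \<le> Enorm d v"
    unfolding Enorm_def by (rule real_sqrt_le_mono)
  then show ?thesis by simp
qed

lemma continuous_on_Enorm:
  assumes "\<And>i. continuous_on S (\<lambda>x. f x i)"
  shows "continuous_on S (\<lambda>x. Enorm d (f x))"
  unfolding Enorm_def by (intro continuous_intros assms)

lemma sphere_d_Enorm: "sphere_d d = {v. (\<forall>i\<ge>d. v i = 0) \<and> Enorm d v = 1}"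
  by (auto simp: sphere_d_def Enorm_def)

lemma ball_d_Enorm: "ball_d d = {v. (\<forall>i\<ge>d. v i = 0) \<and> Enorm d v < 1}"
  by (auto simp: ball_d_def Enorm_def)

text \<open>\<open>E\<close> carries no linear structure of its own: segments exist only in the
  chart, so strict concavity is stated through a point \<open>h\<close> of \<open>E\<close> lying
  over the convex combination. The chart is centred at the maximum point \<open>f0\<close>.\<close>

locale concave_chart =
  fixes E :: "'a::t2_space set" and lam :: "'a \<Rightarrow> real" and u :: "'a \<Rightarrow> nat \<Rightarrow> real"
    and d :: nat and f0 :: 'a
  assumes cont_lam: "continuous_on E lam"
    and compact_superlevel: "\<And>r. compact {f \<in> E. r \<le> lam f}"
    and cont_chart: "\<And>i. continuous_on E (\<lambda>f. u f i)"
    and bij_chart: "bij_betw u E {v. \<forall>i\<ge>d. v i = 0}"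
    and strict_concave: "\<And>f f' t. f \<in> E \<Longrightarrow> f' \<in> E \<Longrightarrow> f \<noteq> f' \<Longrightarrow> 0 < t \<Longrightarrow> t < 1 \<Longrightarrow>
      \<exists>h\<in>E. (\<forall>i. u h i = (1 - t) * u f i + t * u f' i) \<and> (1 - t) * lam f + t * lam f' < lam h"
    and f0: "f0 \<in> E" "\<And>f. f \<in> E \<Longrightarrow> lam f \<le> lam f0" "\<And>i. u f0 i = 0"
begin

section \<open>Depth below the maximum along rays\<close>

definition depth :: "'a \<Rightarrow> real" where "depth f = lam f0 - lam f"

lemma depth_nonneg: "f \<in> E \<Longrightarrow> 0 \<le> depth f"
  using f0 by (simp add: depth_def)

lemma depth_f0: "depth f0 = 0"
  by (simp add: depth_def)

lemma chart_supp: "f \<in> E \<Longrightarrow> d \<le> i \<Longrightarrow> u f i = 0"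
  using bij_chart by (auto simp: bij_betw_def)

lemma chart_inj: "f \<in> E \<Longrightarrow> f' \<in> E \<Longrightarrow> (\<And>i. u f i = u f' i) \<Longrightarrow> f = f'"
  using bij_chart by (auto simp: bij_betw_def inj_on_def fun_eq_iff)

lemma chart_surj: "(\<And>i. d \<le> i \<Longrightarrow> v i = 0) \<Longrightarrow> \<exists>f\<in>E. u f = v"
proof -
  assume "\<And>i. d \<le> i \<Longrightarrow> v i = 0"
  then have "v \<in> u ` E" using bij_chart by (simp add: bij_betw_def)
  then show ?thesis by auto
qed

lemma depth_strict_convex:
  assumes "f \<in> E" "f' \<in> E" "f \<noteq> f'" "h \<in> E" "0 < t" "t < 1"
    and "\<And>i. u h i = (1 - t) * u f i + t * u f' i"
  shows "depth h < (1 - t) * depth f + t * depth f'"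
proof -
  obtain h' where h': "h' \<in> E" "\<forall>i. u h' i = (1 - t) * u f i + t * u f' i"
    "(1 - t) * lam f + t * lam f' < lam h'"
    using strict_concave assms by blast
  have "h' = h" using h' assms by (intro chart_inj) auto
  then show ?thesis using h' by (simp add: depth_def algebra_simps)
qed

lemma depth_eq_0:
  assumes "f \<in> E" "depth f = 0" shows "f = f0"
proof (rule ccontr)
  assume "f \<noteq> f0"
  then obtain h where "h \<in> E" "(1 - 1/2) * lam f + 1/2 * lam f0 < lam h"
    using strict_concave[of f f0 "1/2"] assms f0 by auto
  then show False using assms f0(2)[of h] by (simp add: depth_def)
qed

text \<open>Convexity with value 0 at the origin: \<open>f\<close> divides the segment from
  \<open>f0\<close> to \<open>f'\<close> with weight \<open>t / t'\<close>, so its depth is below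
  that fraction of the depth of \<open>f'\<close>. For \<open>t = 0\<close> the point is the end
  \<open>f0\<close> itself.\<close>

lemma depth_ray_less:
  assumes "f \<in> E" "f' \<in> E" "\<And>i. u f i = t * v i" "\<And>i. u f' i = t' * v i"
    and "0 \<le> t" "t < t'" "f \<noteq> f'"
  shows "depth f < depth f'"
proof (cases "t = 0")
  case True
  then have "f = f0" using assms f0 by (intro chart_inj) auto
  moreover have "depth f' \<noteq> 0" using depth_eq_0 assms calculation by auto
  ultimately show ?thesis using depth_nonneg[OF assms(2)] depth_f0 by auto
next
  case False
  have "f0 \<noteq> f'"
  proof
    assume "f0 = f'"
    then have "t' * v i = 0" for i using assms f0 by metis
    then have "v i = 0" for i using assms by (metis less_le_not_le mult_eq_0_iff)
    then have "f = f'" using assms by (intro chart_inj) auto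
    then show False using assms by simp
  qed
  then have "depth f < (1 - t/t') * depth f0 + t/t' * depth f'"
    using assms False f0 by (intro depth_strict_convex) auto
  also have "\<dots> \<le> 1 * depth f'"
    unfolding depth_f0 using assms depth_nonneg[OF assms(2)]
    by (simp only: mult_zero_right add_0_left) (intro mult_right_mono, auto)
  finally show ?thesis by simp
qed

lemma ray_inj:
  assumes "f \<in> E" "f' \<in> E" "\<And>i. u f i = t * v i" "\<And>i. u f' i = t' * v i"
    and "0 \<le> t" "0 \<le> t'" "depth f = depth f'"
  shows "f = f'"
proof (rule ccontr)
  assume ne: "f \<noteq> f'"
  consider "t < t'" | "t' < t" | "t = t'" by linarith
  then show False
  proof cases
    case 1 then show False using depth_ray_less[of f f' t v t'] assms ne by auto
  next
    case 2 then show False using depth_ray_less[of f' f t' v t] assms ne by auto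
  next
    case 3 then show False using chart_inj[of f f'] assms ne by auto
  qed
qed

text \<open>Along the ray the depth is a convex function on the line, hence continuous without
  continuity of the inverse chart, and it grows at least linearly. The intermediate value theorem
  then reaches every \<open>s\<close>.\<close>

lemma ray_surj:
  assumes "\<And>i. d \<le> i \<Longrightarrow> v i = 0" "Enorm d v = 1" "0 \<le> s"
  shows "\<exists>t\<ge>0. \<exists>f\<in>E. (\<forall>i. u f i = t * v i) \<and> depth f = s"
proof -
  have "\<exists>p. \<forall>t. p t \<in> E \<and> (\<forall>i. u (p t) i = t * v i)"
  proof (intro choice allI)
    fix t
    show "\<exists>f. f \<in> E \<and> (\<forall>i. u f i = t * v i)"
      using chart_surj[of "\<lambda>i. t * v i"] assms(1) by auto
  qed
  then obtain p where p: "\<And>t. p t \<in> E" "\<And>t i. u (p t) i = t * v i" by blast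
  obtain j where j: "v j \<noteq> 0"
    using assms(2) Enorm_eq_0[of d v] by auto
  have inj: "p t \<noteq> p t'" if "t \<noteq> t'" for t t'
    using p(2)[of t j] p(2)[of t' j] j that by auto
  have p0: "p 0 = f0" using p f0 by (intro chart_inj) auto
  define k where "k t = depth (p t)" for t
  have "convex_on UNIV k"
  proof (intro convex_onI)
    fix t x y :: real assume t: "0 < t" "t < 1"
    show "k ((1 - t) *\<^sub>R x + t *\<^sub>R y) \<le> (1 - t) * k x + t * k y"
    proof (cases "x = y")
      case True
      then show ?thesis by (simp add: algebra_simps)
    next
      case False
      then show ?thesis unfolding k_def
        by (intro less_imp_le depth_strict_convex p(1) inj t) (simp_all add: p(2) algebra_simps)
    qed
  qed auto
  then have cont: "continuous_on UNIV k"
    by (intro convex_on_continuous) auto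
  have k0: "k 0 = 0" by (simp add: k_def p0 depth_f0)
  have k1: "k 1 > 0"
    using depth_ray_less[of "p 0" "p 1" 0 v 1] p inj[of 0 1] k0 unfolding k_def by auto
  \<comment> \<open>Linear growth gives \<open>k T \<ge> T * k 1 = k 1 + s\<close>, which exceeds
    \<open>s\<close>.\<close>
  define T where "T = 1 + s / k 1"
  have T1: "1 \<le> T" using k1 assms by (simp add: T_def)
  have "s \<le> k T"
  proof (cases "T = 1")
    case True
    then have "s = 0" using k1 by (simp add: T_def)
    then show ?thesis by (simp add: k_def depth_nonneg p)
  next
    case False
    then have "k 1 < (1 - 1/T) * depth f0 + 1/T * depth (p T)"
      unfolding k_def using T1 p f0 inj[of 0 T]
      by (intro depth_strict_convex) (auto simp: p0)
    then have "T * k 1 < k T" using T1 by (simp add: depth_f0 k_def field_simps)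
    moreover have "T * k 1 = k 1 + s" using k1 by (simp add: T_def field_simps)
    ultimately show ?thesis using k1 by linarith
  qed
  then obtain t where "0 \<le> t" "t \<le> T" "k t = s"
    using IVT'[of k 0 s T] k0 assms T1 continuous_on_subset[OF cont] by auto
  then show ?thesis using p unfolding k_def by blast
qed

section \<open>Radial homeomorphisms onto sphere and ball\<close>

lemma continuous_depth: "continuous_on E depth"
  unfolding depth_def by (intro continuous_intros cont_lam)

lemma Enorm_chart_eq_0: "f \<in> E \<Longrightarrow> Enorm d (u f) = 0 \<Longrightarrow> f = f0"
  using chart_supp f0 by (intro chart_inj) (auto simp: Enorm_eq_0 not_le [symmetric])

text \<open>Radial projection is a continuous bijection from a compact set to a Hausdorff space. The
  strict inequality keeps \<open>f0\<close> out of the level set, so the division is legitimate; for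
  \<open>d = 0\<close> both sides are empty.\<close>

lemma level_homeomorphic_sphere:
  assumes "l < lam f0"
  shows "{f \<in> E. lam f = l} homeomorphic sphere_d d"
proof (rule homeomorphic_compact)
  let ?M = "{f \<in> E. lam f = l}" and ?R = "\<lambda>f i. u f i / Enorm d (u f)"
  have "{f \<in> E. l \<le> lam f} \<inter> lam -` {l} = ?M" by auto
  moreover have "closedin (top_of_set {f \<in> E. l \<le> lam f}) ({f \<in> E. l \<le> lam f} \<inter> lam -` {l})"
    by (intro continuous_closedin_preimage continuous_on_subset[OF cont_lam]) auto
  ultimately show "compact ?M"
    using compact_superlevel[of l] closedin_compact by metis
  have pos: "0 < Enorm d (u f)" if "f \<in> ?M" for f
    using Enorm_chart_eq_0[of f] that assms Enorm_nonneg[of d "u f"] by fastforce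
  show "continuous_on ?M ?R"
    using pos
    by (intro continuous_on_coordinatewise_then_product continuous_on_divide continuous_on_Enorm
        continuous_on_subset[OF cont_chart]) fastforce+
  have scale: "u f i = Enorm d (u f) * (u f i / Enorm d (u f))" if "f \<in> ?M" for f i
    using pos[OF that] by simp
  show "inj_on ?R ?M"
  proof (rule inj_onI)
    fix f f' assume f: "f \<in> ?M" "f' \<in> ?M" and eq: "?R f = ?R f'"
    show "f = f'"
    proof (rule ray_inj)
      show "u f i = Enorm d (u f) * ?R f i" for i using scale[OF f(1)] by simp
      show "u f' i = Enorm d (u f') * ?R f i" for i
        using scale[OF f(2), of i] fun_cong[OF eq, of i] by simp
    qed (use f in \<open>auto simp: Enorm_nonneg depth_def\<close>)
  qed
  show "?R ` ?M = sphere_d d"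
  proof (intro equalityI subsetI)
    fix v assume "v \<in> ?R ` ?M"
    then obtain f where f: "f \<in> ?M" "v = ?R f" by blast
    have "Enorm d v = 1"
      using Enorm_scale[of d "1 / Enorm d (u f)" "u f"] pos[OF f(1)] f by simp
    then show "v \<in> sphere_d d" using f chart_supp by (auto simp: sphere_d_Enorm)
  next
    fix v assume v: "v \<in> sphere_d d"
    then obtain t f where f: "0 \<le> t" "f \<in> E" "\<And>i. u f i = t * v i" "depth f = lam f0 - l"
      using ray_surj[of v "lam f0 - l"] assms by (auto simp: sphere_d_Enorm)
    have M: "f \<in> ?M" using f by (simp add: depth_def)
    have "u f = (\<lambda>i. t * v i)" using f by auto
    then have "Enorm d (u f) = t" using Enorm_scale[of d t v] v f by (simp add: sphere_d_Enorm)
    then have "?R f = v" using f pos[OF M] by auto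
    then show "v \<in> ?R ` ?M" using M by blast
  qed
qed

text \<open>The image of \<open>f\<close> has the direction of \<open>u f\<close> but length
  \<open>\<psi> (depth f)\<close>, so the set becomes round whatever its shape in the chart.
  \<open>\<psi>\<close> rescales the depth interval \<open>S\<close> to [0, 1), which treats bounded
  and unbounded depth at once.\<close>

lemma superlevel_homeomorphic_ball:
  fixes \<psi> :: "real \<Rightarrow> real"
  assumes S: "\<And>s s'. s \<in> S \<Longrightarrow> 0 \<le> s' \<Longrightarrow> s' \<le> s \<Longrightarrow> s' \<in> S" "\<And>s. s \<in> S \<Longrightarrow> 0 \<le> s"
    and cont: "continuous_on S \<psi>"
    and mono: "\<And>s s'. s \<in> S \<Longrightarrow> s' \<in> S \<Longrightarrow> s < s' \<Longrightarrow> \<psi> s < \<psi> s'"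
    and img: "\<psi> ` S = {0..<1}" and psi0: "\<psi> 0 = 0"
  shows "{f \<in> E. depth f \<in> S} homeomorphic ball_d d"
proof -
  let ?M = "{f \<in> E. depth f \<in> S}"
  define R where "R f i = \<psi> (depth f) / Enorm d (u f) * u f i" for f i
  have zero: "0 \<in> S"
  proof -
    have "0 \<in> \<psi> ` S" using img by simp
    then obtain s where "s \<in> S" by auto
    then show ?thesis using S(1)[of s 0] S(2)[of s] by auto
  qed
  have psi_range: "0 \<le> \<psi> (depth f)" "\<psi> (depth f) < 1" if "f \<in> ?M" for f
    using img that by auto
  have inj: "s = s'" if "s \<in> S" "s' \<in> S" "\<psi> s = \<psi> s'" for s s'
    using mono[of s s'] mono[of s' s] that by (cases s s' rule: linorder_cases) auto
  have pos: "0 < Enorm d (u f)" if "f \<in> E" "f \<noteq> f0" for f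
    using Enorm_chart_eq_0[of f] that Enorm_nonneg[of d "u f"] by fastforce
  have R0: "R f0 i = 0" for i by (simp add: R_def f0)
  have NR: "Enorm d (R f) = \<psi> (depth f)" if "f \<in> ?M" for f
  proof (cases "f = f0")
    case True
    then show ?thesis by (simp add: Enorm_eq_0 R0 depth_f0 psi0)
  next
    case False
    then show ?thesis
      using Enorm_scale[of d "\<psi> (depth f) / Enorm d (u f)" "u f"] pos[of f] psi_range[OF that] that
      by (simp add: R_def[abs_def])
  qed
  have supp: "R f i = 0" if "f \<in> ?M" "d \<le> i" for f i
    using chart_supp that by (simp add: R_def)
  have cont_psi: "continuous_on ?M (\<lambda>f. \<psi> (depth f))"
    by (rule continuous_on_compose2[OF cont continuous_on_subset[OF continuous_depth]]) auto
  have contR: "continuous_on ?M R"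
  proof (intro continuous_on_coordinatewise_then_product)
    fix i
    show "continuous_on ?M (\<lambda>f. R f i)"
      unfolding continuous_on_eq_continuous_within
    proof
      fix f assume f: "f \<in> ?M"
      show "continuous (at f within ?M) (\<lambda>f. R f i)"
      proof (cases "f = f0")
        case True
        \<comment> \<open>The direction of \<open>u h\<close> need not have a limit at
          \<open>f0\<close>, but each coordinate is bounded by the length
          \<open>\<psi> (depth h)\<close>, which tends to 0.\<close>
        have le: "\<bar>R h i\<bar> \<le> \<psi> (depth h)" if "h \<in> ?M" for h
        proof (cases "i < d")
          case True
          then show ?thesis using abs_le_Enorm[of i d "R h"] NR[OF that] by simp
        next
          case False
          then show ?thesis using supp[OF that] psi_range[OF that] by simp
        qed
        have "((\<lambda>h. \<psi> (depth h)) \<longlongrightarrow> \<psi> (depth f)) (at f within ?M)"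
          using cont_psi f by (simp add: continuous_on_def)
        then have lim: "((\<lambda>h. \<psi> (depth h)) \<longlongrightarrow> 0) (at f within ?M)"
          using True by (simp add: depth_f0 psi0)
        have "eventually (\<lambda>h. h \<in> ?M) (at f within ?M)"
          by (simp add: eventually_at_filter)
        then have ev: "eventually (\<lambda>h. norm (R h i) \<le> \<psi> (depth h)) (at f within ?M)"
          by eventually_elim (use le in simp)
        have "((\<lambda>h. R h i) \<longlongrightarrow> 0) (at f within ?M)"
          by (rule Lim_null_comparison[OF ev lim])
        then show ?thesis using True R0 by (simp add: continuous_within)
      next
        case False
        have "continuous (at f within ?M) (\<lambda>f. \<psi> (depth f))"
          "continuous (at f within ?M) (\<lambda>f. Enorm d (u f))"
          "continuous (at f within ?M) (\<lambda>f. u f i)"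
          using f cont_psi continuous_on_Enorm[of ?M u d] continuous_on_subset[OF cont_chart, of ?M]
          by (auto simp: continuous_on_eq_continuous_within)
        then show ?thesis unfolding R_def
          using pos[of f] f False
          by (intro continuous_mult continuous_at_within_divide) auto
      qed
    qed
  qed
  have injR: "inj_on R ?M"
  proof (rule inj_onI)
    fix f f' assume f: "f \<in> ?M" "f' \<in> ?M" and eq: "R f = R f'"
    have dd: "depth f = depth f'" using inj NR[OF f(1)] NR[OF f(2)] eq f by auto
    show "f = f'"
    proof (cases "depth f = 0")
      case True
      then show ?thesis using dd f depth_eq_0 by auto
    next
      case False
      then have nz: "f \<noteq> f0" "f' \<noteq> f0" using dd depth_f0 by auto
      have psi: "\<psi> (depth f) \<noteq> 0" using inj[of "depth f" 0] zero f False psi0 by auto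
      show ?thesis
      proof (rule ray_inj)
        show "u f i = Enorm d (u f) / \<psi> (depth f) * R f i" for i
          using pos[OF _ nz(1)] f psi by (simp add: R_def)
        show "u f' i = Enorm d (u f') / \<psi> (depth f) * R f i" for i
          unfolding eq using pos[OF _ nz(2)] f psi dd by (simp add: R_def)
        show "0 \<le> Enorm d (u f) / \<psi> (depth f)" "0 \<le> Enorm d (u f') / \<psi> (depth f)"
          using psi_range[OF f(1)] by (auto simp: Enorm_nonneg)
      qed (use f dd in auto)
    qed
  qed
  have imgR: "R ` ?M = ball_d d"
  proof (intro equalityI subsetI)
    fix v assume "v \<in> R ` ?M"
    then show "v \<in> ball_d d" using NR supp psi_range by (auto simp: ball_d_Enorm)
  next
    fix w assume w: "w \<in> ball_d d"
    then have "Enorm d w \<in> \<psi> ` S" by (simp add: img Enorm_nonneg ball_d_Enorm)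
    then obtain s where s: "s \<in> S" "\<psi> s = Enorm d w" by auto
    show "w \<in> R ` ?M"
    proof (cases "Enorm d w = 0")
      case True
      then have "w i = 0" for i
        using w by (cases "i < d") (auto simp: Enorm_eq_0 ball_d_Enorm)
      then have "w = R f0" using R0 by auto
      then show ?thesis using f0 zero depth_f0 by auto
    next
      case False
      define v where "v i = 1 / Enorm d w * w i" for i
      have pw: "0 < Enorm d w" using False Enorm_nonneg[of d w] by simp
      have "Enorm d v = 1" using Enorm_scale[of d "1 / Enorm d w" w] pw by (simp add: v_def[abs_def])
      moreover have "v i = 0" if "d \<le> i" for i using w that by (simp add: v_def ball_d_Enorm)
      ultimately obtain t f where f: "0 \<le> t" "f \<in> E" "\<And>i. u f i = t * v i" "depth f = s"
        using ray_surj[of v s] S(2)[OF s(1)] by auto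
      have "u f = (\<lambda>i. t * v i)" using f by auto
      then have t: "Enorm d (u f) = t"
        using Enorm_scale[of d t v] f \<open>Enorm d v = 1\<close> by simp
      have "f \<noteq> f0" using f s psi0 False depth_f0 by auto
      then have "0 < t" using pos f t by auto
      then have "R f = w" using f t s pw by (auto simp: R_def v_def)
      then show ?thesis using f s by auto
    qed
  qed
  define g where "g = inv_into ?M R"
  have gR: "g (R f) = f" if "f \<in> ?M" for f
    unfolding g_def by (rule inv_into_f_f[OF injR that])
  \<comment> \<open>For \<open>Enorm d w < r < 1\<close> a compact superlevel set is mapped
    homeomorphically onto a set containing the ball of radius \<open>r\<close> about the origin,
    which is a neighbourhood of \<open>w\<close>.\<close>
  have contg: "continuous_on (ball_d d) g"
    unfolding continuous_on_eq_continuous_within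
  proof
    fix w assume w: "w \<in> ball_d d"
    obtain r where r: "Enorm d w < r" "r < 1" using w dense[of "Enorm d w" 1] by (auto simp: ball_d_Enorm)
    have r0: "0 \<le> r" using r Enorm_nonneg[of d w] by simp
    then have "r \<in> \<psi> ` S" using r by (simp add: img)
    then obtain s where s: "s \<in> S" "\<psi> s = r" by auto
    let ?K = "{f \<in> E. lam f0 - s \<le> lam f}"
    have KM: "?K \<subseteq> ?M"
      using S(1)[OF s(1)] depth_nonneg by (auto simp: depth_def)
    have "continuous_on (R ` ?K) g"
      using continuous_on_subset[OF contR KM] compact_superlevel KM gR
      by (intro continuous_on_inv) auto
    moreover have sub: "{v \<in> ball_d d. Enorm d v < r} \<subseteq> R ` ?K"
    proof
      fix v assume v: "v \<in> {v \<in> ball_d d. Enorm d v < r}"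
      then obtain f where f: "f \<in> ?M" "v = R f" using imgR by blast
      then have "\<psi> (depth f) < \<psi> s" using v NR s by auto
      then have "depth f \<le> s" using mono[of s "depth f"] f s by force
      then have "f \<in> ?K" using f by (auto simp: depth_def)
      then show "v \<in> R ` ?K" using f by blast
    qed
    ultimately have "continuous_on {v \<in> ball_d d. Enorm d v < r} g"
      using continuous_on_subset by blast
    then have "continuous (at w within {v \<in> ball_d d. Enorm d v < r}) g"
      using w r by (auto simp: continuous_on_eq_continuous_within)
    moreover have "at w within {v \<in> ball_d d. Enorm d v < r} = at w within ball_d d"
    proof (rule at_within_nhd)
      show "w \<in> {v. Enorm d v < r}" using r by simp
      show "open {v. Enorm d v < r}"
        by (intro open_Collect_less continuous_on_Enorm continuous_on_const) simp
    qed auto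
    ultimately show "continuous (at w within ball_d d) g" by simp
  qed
  have "homeomorphism ?M (ball_d d) R g"
    unfolding homeomorphism_def
  proof (intro conjI ballI)
    show "g ` ball_d d = ?M" unfolding imgR[symmetric] image_image using gR by force
    show "R (g w) = w" if "w \<in> ball_d d" for w
      using that gR unfolding imgR[symmetric] by auto
  qed (use gR imgR contR contg in auto)
  then show ?thesis unfolding homeomorphic_def by blast
qed

end

theorem concave_level_sets:
  fixes E :: "'a::t2_space set" and lam :: "'a \<Rightarrow> real" and \<theta> :: "'a \<Rightarrow> nat \<Rightarrow> real"
  assumes "E \<noteq> {}"
    and cont: "continuous_on E lam" and compact: "\<And>r. compact {f \<in> E. r \<le> lam f}"
    and cont_chart: "\<And>i. continuous_on E (\<lambda>f. \<theta> f i)"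
    and bij: "bij_betw \<theta> E {v. \<forall>i\<ge>d. v i = 0}"
    and concave: "\<And>f f' t. f \<in> E \<Longrightarrow> f' \<in> E \<Longrightarrow> f \<noteq> f' \<Longrightarrow> 0 < t \<Longrightarrow> t < 1 \<Longrightarrow>
      \<exists>h\<in>E. (\<forall>i. \<theta> h i = (1 - t) * \<theta> f i + t * \<theta> f' i) \<and> (1 - t) * lam f + t * lam f' < lam h"
  shows "\<exists>lam0. (\<forall>l>lam0. {f \<in> E. lam f = l} = {}) \<and> (\<exists>f. {f \<in> E. lam f = lam0} = {f}) \<and>
    (\<forall>l<lam0. {f \<in> E. lam f = l} homeomorphic sphere_d d) \<and>
    (\<forall>l::ereal. l < ereal lam0 \<longrightarrow>
      {f \<in> E. l < ereal (lam f) \<and> lam f \<le> lam0} homeomorphic ball_d d)"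
proof -
  obtain e where e: "e \<in> E" using \<open>E \<noteq> {}\<close> by blast
  \<comment> \<open>A maximum over the nonempty compact superlevel set through \<open>e\<close> is a
    global maximum.\<close>
  have "\<exists>f\<in>{f \<in> E. lam e \<le> lam f}. \<forall>h\<in>{f \<in> E. lam e \<le> lam f}. lam h \<le> lam f"
    using e by (intro continuous_attains_sup compact continuous_on_subset[OF cont]) auto
  then obtain f0 where f0: "f0 \<in> E" "\<And>f. f \<in> E \<Longrightarrow> lam f \<le> lam f0"
    by (smt (verit) mem_Collect_eq)
  define u where "u f i = \<theta> f i - \<theta> f0 i" for f i
  have supp: "\<theta> f i = 0" if "f \<in> E" "d \<le> i" for f i
    using bij that by (auto simp: bij_betw_def)
  interpret concave_chart E lam u d f0
  proof
    show "continuous_on E (\<lambda>f. u f i)" for i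
      unfolding u_def by (intro continuous_intros cont_chart)
    show "bij_betw u E {v. \<forall>i\<ge>d. v i = 0}"
      unfolding bij_betw_def
    proof (intro conjI equalityI subsetI)
      have "\<theta> f = \<theta> f'" if "u f = u f'" for f f'
        using that by (auto simp: u_def fun_eq_iff)
      then show "inj_on u E"
        using bij unfolding bij_betw_def inj_on_def by blast
      fix v assume v: "v \<in> {v. \<forall>i\<ge>d. v i = (0::real)}"
      then have "(\<lambda>i. v i + \<theta> f0 i) \<in> \<theta> ` E"
        using bij supp[OF f0(1)] by (simp add: bij_betw_def)
      then obtain f where f: "f \<in> E" "\<theta> f = (\<lambda>i. v i + \<theta> f0 i)" by auto
      then have "u f = v" by (simp add: u_def fun_eq_iff)
      then show "v \<in> u ` E" using f by blast
    qed (use supp f0 in \<open>auto simp: u_def\<close>)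
    show "\<exists>h\<in>E. (\<forall>i. u h i = (1 - t) * u f i + t * u f' i) \<and> (1 - t) * lam f + t * lam f' < lam h"
      if "f \<in> E" "f' \<in> E" "f \<noteq> f'" "0 < t" "t < 1" for f f' t
      using concave[OF that] by (auto simp: u_def algebra_simps)
  qed (use cont compact f0 in \<open>auto simp: u_def\<close>)
  show ?thesis
  proof (intro exI[of _ "lam f0"] conjI allI impI)
    show "{f \<in> E. lam f = l} = {}" if "lam f0 < l" for l
      using f0(2) that by force
    have "{f \<in> E. lam f = lam f0} = {f0}"
      using depth_eq_0 f0 by (auto simp: depth_def)
    then show "\<exists>f. {f \<in> E. lam f = lam f0} = {f}" by blast
    show "{f \<in> E. lam f = l} homeomorphic sphere_d d" if "l < lam f0" for l
      by (rule level_homeomorphic_sphere[OF that])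
    fix l :: ereal assume l: "l < ereal (lam f0)"
    show "{f \<in> E. l < ereal (lam f) \<and> lam f \<le> lam f0} homeomorphic ball_d d"
    proof (cases l)
      case (real r)
      define R where "R = lam f0 - r"
      have R: "R > 0" using l real by (simp add: R_def)
      have "{f \<in> E. depth f \<in> {0..<R}} homeomorphic ball_d d"
      proof (rule superlevel_homeomorphic_ball)
        show "continuous_on {0..<R} (\<lambda>s. s / R)" using R by (intro continuous_intros) auto
        show "(\<lambda>s. s / R) ` {0..<R} = {0..<1}"
        proof (intro equalityI subsetI)
          fix y assume "y \<in> {0..<1::real}"
          then show "y \<in> (\<lambda>s. s / R) ` {0..<R}"
            using R by (intro image_eqI[of _ _ "y * R"]) auto
        qed (use R in auto)
      qed (use R in \<open>auto simp: divide_strict_right_mono\<close>)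
      moreover have "{f \<in> E. depth f \<in> {0..<R}} = {f \<in> E. l < ereal (lam f) \<and> lam f \<le> lam f0}"
        using real by (auto simp: depth_def R_def)
      ultimately show ?thesis by simp
    next
      case MInf
      \<comment> \<open>For \<open>l = -\<infinity>\<close> the depth is unrestricted, and
        \<open>s / (1 + s)\<close> compresses the half-line to [0, 1).\<close>
      have "{f \<in> E. depth f \<in> {0..}} homeomorphic ball_d d"
      proof (rule superlevel_homeomorphic_ball)
        show "continuous_on {0..} (\<lambda>s::real. s / (1 + s))" by (intro continuous_intros) auto
        show "(\<lambda>s::real. s / (1 + s)) ` {0..} = {0..<1}"
        proof (intro equalityI subsetI)
          fix y assume "y \<in> {0..<1::real}"
          then show "y \<in> (\<lambda>s. s / (1 + s)) ` {0..}"
            by (intro image_eqI[of _ _ "y / (1 - y)"]) (auto simp: field_simps)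
        qed auto
      qed (auto simp: field_simps)
      moreover have "{f \<in> E. depth f \<in> {0..}} = {f \<in> E. l < ereal (lam f) \<and> lam f \<le> lam f0}"
        using MInf by (auto simp: depth_def)
      ultimately show ?thesis by simp
    qed (use l in auto)
  qed
qed

section \<open>Coordinates on a space of functions separated by finitely many points\<close>

text \<open>Take a separating subset \<open>K\<close> of \<open>F\<close> minimal under inclusion.
  Dropping \<open>k\<close> destroys separation, which yields an element vanishing on the rest of
  \<open>K\<close> but not at \<open>k\<close>. Normalized, these are dual to the evaluations, so
  \<open>d\<close> is the size of \<open>K\<close>.\<close>

lemma evaluation_coordinates:
  fixes A :: "('a \<Rightarrow> real) set"
  assumes zero: "(\<lambda>_. 0) \<in> A"
    and add: "\<And>\<alpha> \<beta>. \<alpha> \<in> A \<Longrightarrow> \<beta> \<in> A \<Longrightarrow> (\<lambda>x. \<alpha> x + \<beta> x) \<in> A"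
    and scale: "\<And>\<alpha> r. \<alpha> \<in> A \<Longrightarrow> (\<lambda>x. r * \<alpha> x) \<in> A"
    and "finite F" "\<forall>\<alpha>\<in>A. (\<forall>x\<in>F. \<alpha> x = 0) \<longrightarrow> \<alpha> = (\<lambda>_. 0)"
  shows "\<exists>(d::nat) e. e ` {..<d} \<subseteq> F \<and>
    (\<forall>\<alpha>\<in>A. (\<forall>i<d. \<alpha> (e i) = 0) \<longrightarrow> \<alpha> = (\<lambda>_. 0)) \<and>
    (\<forall>v. \<exists>\<alpha>\<in>A. \<forall>i<d. \<alpha> (e i) = v i)"
proof -
  define sep where "sep K \<longleftrightarrow> (\<forall>\<alpha>\<in>A. (\<forall>x\<in>K. \<alpha> x = 0) \<longrightarrow> \<alpha> = (\<lambda>_. 0))" for K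
  have "sep F" unfolding sep_def using assms(5) by blast
  then have "finite {K. K \<subseteq> F \<and> sep K}" "{K. K \<subseteq> F \<and> sep K} \<noteq> {}"
    using \<open>finite F\<close> by auto
  then obtain K where K: "K \<subseteq> F" "sep K" and
    min: "\<And>K'. K' \<subseteq> F \<Longrightarrow> sep K' \<Longrightarrow> K' \<subseteq> K \<Longrightarrow> K' = K"
    using finite_has_minimal[of "{K. K \<subseteq> F \<and> sep K}"] by (metis (no_types, lifting) mem_Collect_eq)
  have fin: "finite K" using K \<open>finite F\<close> finite_subset by auto
  have "\<exists>\<beta>\<in>A. \<beta> k = 1 \<and> (\<forall>x\<in>K - {k}. \<beta> x = 0)" if k: "k \<in> K" for k
  proof -
    have "\<not> sep (K - {k})" using min[of "K - {k}"] K k by auto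
    then obtain \<alpha> where \<alpha>: "\<alpha> \<in> A" "\<forall>x\<in>K - {k}. \<alpha> x = 0" "\<alpha> \<noteq> (\<lambda>_. 0)"
      unfolding sep_def by blast
    then have "\<alpha> k \<noteq> 0" using K(2) unfolding sep_def by (metis Diff_iff singletonD)
    then show ?thesis
      using \<alpha> by (intro bexI[of _ "\<lambda>x. 1 / \<alpha> k * \<alpha> x"] scale) auto
  qed
  then obtain \<beta> where \<beta>: "\<And>k. k \<in> K \<Longrightarrow> \<beta> k \<in> A" "\<And>k. k \<in> K \<Longrightarrow> \<beta> k k = 1"
    "\<And>k x. k \<in> K \<Longrightarrow> x \<in> K - {k} \<Longrightarrow> \<beta> k x = 0"
    by metis
  obtain e where e: "bij_betw e {..<card K} K"
    using ex_bij_betw_nat_finite[OF fin] by (auto simp: atLeast0LessThan)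
  have sumA: "(\<lambda>x. \<Sum>k\<in>J. w k * \<beta> k x) \<in> A" if "finite J" "J \<subseteq> K" for w J
    using that
  proof (induction J)
    case empty
    then show ?case using zero by simp
  next
    case (insert k J)
    then show ?case
      using add[OF scale[of "\<beta> k" "w k"]] \<beta>(1) by simp
  qed
  show ?thesis
  proof (intro exI[of _ "card K"] exI[of _ e] conjI ballI allI impI)
    show "e ` {..<card K} \<subseteq> F" using e K by (auto simp: bij_betw_def)
    show "\<alpha> = (\<lambda>_. 0)" if "\<alpha> \<in> A" "\<forall>i<card K. \<alpha> (e i) = 0" for \<alpha>
    proof -
      have "K = e ` {..<card K}" using e by (simp add: bij_betw_def)
      then have "\<forall>x\<in>K. \<alpha> x = 0" using that(2) by (metis imageE lessThan_iff)
      then show ?thesis using K(2) \<open>\<alpha> \<in> A\<close> by (simp add: sep_def)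
    qed
    fix v :: "nat \<Rightarrow> real"
    define w where "w k = v (inv_into {..<card K} e k)" for k
    have "(\<Sum>k\<in>K. w k * \<beta> k (e i)) = v i" if i: "i < card K" for i
    proof -
      have ei: "e i \<in> K" using e i by (auto simp: bij_betw_def)
      have "(\<Sum>k\<in>K. w k * \<beta> k (e i)) = (\<Sum>k\<in>K. if k = e i then w k else 0)"
        by (rule sum.cong) (use \<beta> ei in auto)
      also have "\<dots> = w (e i)" using ei fin by simp
      also have "\<dots> = v i"
        unfolding w_def using e i by (simp add: bij_betw_def)
      finally show ?thesis .
    qed
    then show "\<exists>\<alpha>\<in>A. \<forall>i<card K. \<alpha> (e i) = v i"
      using sumA[OF fin order.refl, of w] by (intro bexI) auto
  qed
qed

section \<open>Equivariant supersolutions on a cocompact graph\<close>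

text \<open>Strict inequalities at finitely many points survive a small perturbation. The bound
  \<open>\<epsilon> < 1\<close> later keeps a lowered supersolution positive.\<close>

lemma small_multiplier:
  fixes p q :: "'a \<Rightarrow> real"
  assumes "finite V" "\<And>z. z \<in> V \<Longrightarrow> 0 < p z"
  obtains \<epsilon> where "0 < \<epsilon>" "\<epsilon> < 1" "\<And>z. z \<in> V \<Longrightarrow> \<epsilon> * q z < p z"
proof -
  have "\<exists>\<epsilon>>0. \<epsilon> < 1 \<and> (\<forall>z\<in>V. \<epsilon> * \<bar>q z\<bar> < p z)"
    using assms
  proof (induction V)
    case empty
    show ?case by (intro exI[of _ "1/2"]) auto
  next
    case (insert z V)
    then obtain \<epsilon> where \<epsilon>: "\<epsilon> > 0" "\<epsilon> < 1" "\<forall>z\<in>V. \<epsilon> * \<bar>q z\<bar> < p z" by auto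
    \<comment> \<open>The added 1 covers \<open>q z = 0\<close> and makes the inequality
      strict.\<close>
    define \<delta> where "\<delta> = p z / (\<bar>q z\<bar> + 1)"
    have pz: "0 < p z" using insert by simp
    have \<delta>: "0 < \<delta>" "\<delta> * \<bar>q z\<bar> < p z"
      using pz by (auto simp: \<delta>_def field_simps add_strict_increasing2)
    have "min \<epsilon> \<delta> * \<bar>q w\<bar> \<le> \<epsilon> * \<bar>q w\<bar>" "min \<epsilon> \<delta> * \<bar>q w\<bar> \<le> \<delta> * \<bar>q w\<bar>" for w
      by (auto intro: mult_right_mono)
    then show ?case
      using \<epsilon> \<delta> by (intro exI[of _ "min \<epsilon> \<delta>"]) (auto intro: le_less_trans)
  qed
  then obtain \<epsilon> where "\<epsilon> > 0" "\<epsilon> < 1" "\<forall>z\<in>V. \<epsilon> * \<bar>q z\<bar> < p z" by blast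
  moreover from this have "\<epsilon> * q z \<le> \<epsilon> * \<bar>q z\<bar>" for z by simp
  ultimately show ?thesis using that by (meson le_less_trans)
qed

text \<open>The tangent of \<open>ln\<close> at the arithmetic mean \<open>m\<close> bounds both
  logarithms, and the linear terms cancel in the weighted sum. Equality forces
  \<open>ln (x / m) = x / m - 1\<close>, hence \<open>x = m\<close>, and likewise
  \<open>y = m\<close>.\<close>

lemma weighted_am_gm:
  fixes x y t :: real
  assumes "0 < x" "0 < y" "0 < t" "t < 1"
  shows "exp ((1 - t) * ln x + t * ln y) \<le> (1 - t) * x + t * y"
    and "exp ((1 - t) * ln x + t * ln y) = (1 - t) * x + t * y \<Longrightarrow> x = y"
proof -
  define m where "m = (1 - t) * x + t * y"
  have m: "0 < m" using assms by (simp add: m_def add_pos_pos)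
  have lx: "ln x \<le> ln m + (x / m - 1)" and ly: "ln y \<le> ln m + (y / m - 1)"
    using ln_le_minus_one[of "x / m"] ln_le_minus_one[of "y / m"] m assms by (auto simp: ln_div)
  have one: "(1 - t) * (x / m - 1) + t * (y / m - 1) = 0"
  proof -
    have "(1 - t) * (x / m - 1) + t * (y / m - 1) = ((1 - t) * x + t * y) / m - 1"
      by (simp add: field_simps add_divide_distrib diff_divide_distrib)
    then show ?thesis using m by (simp add: m_def)
  qed
  have ax: "(1 - t) * ln x \<le> (1 - t) * (ln m + (x / m - 1))" using lx assms by (intro mult_left_mono) auto
  have ay: "t * ln y \<le> t * (ln m + (y / m - 1))" using ly assms by (intro mult_left_mono) auto
  have sum: "(1 - t) * (ln m + (x / m - 1)) + t * (ln m + (y / m - 1)) = ln m"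
    using one by (simp add: algebra_simps)
  have le: "(1 - t) * ln x + t * ln y \<le> ln m" using ax ay sum by linarith
  then have "exp ((1 - t) * ln x + t * ln y) \<le> exp (ln m)" by simp
  also have "exp (ln m) = m" using m by simp
  finally show "exp ((1 - t) * ln x + t * ln y) \<le> (1 - t) * x + t * y"
    by (simp add: m_def)
  assume "exp ((1 - t) * ln x + t * ln y) = (1 - t) * x + t * y"
  then have "(1 - t) * ln x + t * ln y = ln m" using m by (metis ln_exp m_def)
  then have "(1 - t) * ln x = (1 - t) * (ln m + (x / m - 1))" "t * ln y = t * (ln m + (y / m - 1))"
    using ax ay sum by linarith+
  then have "ln (x / m) = x / m - 1" "ln (y / m) = y / m - 1"
    using assms m by (auto simp: ln_div)
  then have "x / m = 1" "y / m = 1" using ln_eq_minus_one assms m by (metis divide_pos_pos)+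
  then show "x = y" using m by simp
qed

lemma closed_Collect_ball:
  assumes "\<And>x. x \<in> A \<Longrightarrow> closed {h. P h x}"
  shows "closed {h. \<forall>x\<in>A. P h x}"
proof -
  have "{h. \<forall>x\<in>A. P h x} = (\<Inter>x\<in>A. {h. P h x})" by auto
  then show ?thesis using assms by (simp add: closed_INT)
qed

lemma compact_box:
  fixes C :: "'a \<Rightarrow> real"
  shows "compact {h. \<forall>x. h x \<in> {0..C x}}"
proof -
  have "compactin (product_topology (\<lambda>_. euclidean) UNIV) (PiE UNIV (\<lambda>x. {0..C x}))"
    unfolding compactin_PiE by simp
  moreover have "PiE UNIV (\<lambda>x. {0..C x}) = {h. \<forall>x. h x \<in> {0..C x}}"
    by (auto simp: PiE_def Pi_def)
  ultimately show ?thesis by (simp add: euclidean_product_topology)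
qed

section \<open>The operator as a finite sum\<close>

locale cocompact_graph =
  fixes b :: "'x::countable \<Rightarrow> 'x \<Rightarrow> real" and c :: "'x \<Rightarrow> real"
    and G :: "('g, 'm) monoid_scheme" and \<phi> :: "'g \<Rightarrow> 'x \<Rightarrow> 'x" and x0 :: 'x
  assumes graph: "graph b" and locally_finite: "locally_finite b"
    and connected: "connected_graph b"
    and action: "group_action G UNIV \<phi>"
    and cocompact: "cocompact G \<phi>"
    and invariant: "H_invariant G \<phi> b c"
begin

interpretation group_action G UNIV \<phi> by (rule action)

lemma group_G: "group G"
  using group_hom.axioms(1)[OF group_hom] .

interpretation G: group G by (rule group_G)

abbreviation "H \<equiv> Hop b c"

definition nb :: "'x \<Rightarrow> 'x set" where "nb x = {y. 0 < b x y}"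

text \<open>A loop enters both \<open>diag x\<close> and the sum over \<open>nb x\<close>, and
  cancels in \<open>H\<close>.\<close>

definition diag :: "'x \<Rightarrow> real" where "diag x = (\<Sum>y\<in>nb x. b x y) + c x"

lemma finite_nb: "finite (nb x)"
  using locally_finite by (simp add: locally_finite_def nb_def)

lemma b_nonneg: "0 \<le> b x y"
  using graph by (simp add: graph_def)

lemma b_outside: "y \<notin> nb x \<Longrightarrow> b x y = 0"
  using b_nonneg[of x y] by (simp add: nb_def)

text \<open>Local finiteness reduces the series to a finite sum. This makes \<open>H\<close>
  available on all functions and continuous for pointwise convergence.\<close>

lemma H_eq: "H f x = diag x * f x - (\<Sum>y\<in>nb x. b x y * f y)"
proof -
  have "(\<Sum>\<^sub>\<infinity>y. b x y * (f x - f y)) = (\<Sum>\<^sub>\<infinity>y\<in>nb x. b x y * (f x - f y))"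
    by (rule infsum_cong_neutral) (auto simp: b_outside)
  also have "\<dots> = (\<Sum>y\<in>nb x. b x y * (f x - f y))"
    using finite_nb by simp
  finally show ?thesis
    by (simp add: Hop_def diag_def algebra_simps sum_subtractf sum_distrib_left)
qed

lemma in_domH: "f \<in> domH b"
  unfolding domH_def
proof safe
  fix x
  have "(\<lambda>y. b x y * \<bar>f y\<bar>) summable_on nb x \<longleftrightarrow> (\<lambda>y. b x y * \<bar>f y\<bar>) summable_on UNIV"
    by (rule summable_on_cong_neutral) (auto simp: b_outside)
  then show "(\<lambda>y. b x y * \<bar>f y\<bar>) summable_on UNIV" using finite_nb by simp
qed

lemma H_scale: "H (\<lambda>x. k * f x) x = k * H f x"
  by (simp add: H_eq algebra_simps sum_distrib_left)

lemma H_diff: "H (\<lambda>x. f x - k * h x) x = H f x - k * H h x"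
  by (simp add: H_eq algebra_simps sum_subtractf sum_distrib_left)

lemma continuous_on_H: "continuous_on S (\<lambda>f. H f x)"
  unfolding H_eq by (intro continuous_intros continuous_on_product_then_coordinatewise)

text \<open>Minimum principle: where a nonnegative \<open>w\<close> vanishes only the off-diagonal
  terms of \<open>H\<close> remain, all nonpositive. The choice \<open>y = x\<close> gives
  \<open>H w x \<le> 0\<close>.\<close>

lemma H_le_at_zero:
  assumes "\<And>y. 0 \<le> w y" "w x = 0" shows "H w x \<le> - b x y * w y"
proof (cases "y \<in> nb x")
  case True
  then have "b x y * w y \<le> (\<Sum>y\<in>nb x. b x y * w y)"
    by (intro member_le_sum) (auto simp: finite_nb b_nonneg assms)
  then show ?thesis using assms by (simp add: H_eq)
next
  case False
  have "0 \<le> (\<Sum>y\<in>nb x. b x y * w y)" by (intro sum_nonneg) (simp add: b_nonneg assms)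
  then show ?thesis using False assms by (simp add: H_eq b_outside)
qed

lemma path_induct:
  assumes "P x" "\<And>x y. P x \<Longrightarrow> 0 < b x y \<Longrightarrow> P y" shows "P y"
proof -
  have "(\<lambda>u v. b u v > 0)\<^sup>*\<^sup>* x y" using connected by (simp add: connected_graph_def)
  then show ?thesis by induction (use assms in auto)
qed

subsection \<open>The action\<close>

lemma act_mult: "g \<in> carrier G \<Longrightarrow> h \<in> carrier G \<Longrightarrow> \<phi> (g \<otimes>\<^bsub>G\<^esub> h) x = \<phi> g (\<phi> h x)"
  using composition_rule by simp

lemma act_one: "\<phi> \<one>\<^bsub>G\<^esub> x = x"
  using fun_cong[OF id_eq_one, of x] by simp

lemma act_inv: "g \<in> carrier G \<Longrightarrow> \<phi> (inv\<^bsub>G\<^esub> g) (\<phi> g x) = x"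
  "g \<in> carrier G \<Longrightarrow> \<phi> g (\<phi> (inv\<^bsub>G\<^esub> g) x) = x"
  using act_mult[of "inv\<^bsub>G\<^esub> g" g x] act_mult[of g "inv\<^bsub>G\<^esub> g" x] act_one by auto

lemma H_act:
  assumes "g \<in> carrier G"
  shows "H f (\<phi> g x) = H (\<lambda>x. f (\<phi> g x)) x"
proof -
  have "H (Tg \<phi> G (inv\<^bsub>G\<^esub> g) f) = Tg \<phi> G (inv\<^bsub>G\<^esub> g) (H f)"
    using invariant in_domH assms by (simp add: H_invariant_def)
  from fun_cong[OF this, of x] show ?thesis
    using assms by (simp add: Tg_def)
qed

text \<open>The off-diagonal entries of \<open>H\<close> are its values on indicators of points, so
  invariance of \<open>H\<close> passes to \<open>b\<close>. Loops cancel in \<open>H\<close>,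
  whence \<open>x \<noteq> y\<close>.\<close>

lemma b_act:
  assumes g: "g \<in> carrier G" and "x \<noteq> y"
  shows "b (\<phi> g x) (\<phi> g y) = b x y"
proof -
  have inj: "\<phi> g z = \<phi> g y \<longleftrightarrow> z = y" for z using act_inv(1)[OF g] by metis
  have *: "H (\<lambda>z. if z = w then 1 else 0) v = - b v w" if "v \<noteq> w" for v w
  proof -
    have "(\<Sum>y\<in>nb v. b v y * (if y = w then 1 else 0)) = (\<Sum>y\<in>nb v. if y = w then b v y else 0)"
      by (rule sum.cong) auto
    then show ?thesis using that finite_nb b_outside[of w v] by (simp add: H_eq)
  qed
  have "H (\<lambda>z. if z = \<phi> g y then 1 else 0) (\<phi> g x) = H (\<lambda>z. if z = y then 1 else 0) x"
    using H_act[OF g, of "\<lambda>z. if z = \<phi> g y then 1 else 0" x] by (simp add: inj)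
  then show ?thesis using *[of x y] *[of "\<phi> g x" "\<phi> g y"] assms inj by simp
qed

section \<open>A finite set meeting every orbit\<close>

definition V :: "'x set" where
  "V = (SOME V. finite V \<and> (\<Union>g\<in>carrier G. \<phi> g ` V) = UNIV)"

lemma V: "finite V" "(\<Union>g\<in>carrier G. \<phi> g ` V) = UNIV"
  using someI_ex[OF cocompact[unfolded cocompact_def]] unfolding V_def by auto

text \<open>The condition on \<open>v\<close> depends only on the orbit of \<open>x\<close>, so the
  same representative is chosen along the orbit even if \<open>V\<close> meets it several
  times.\<close>

definition rep :: "'x \<Rightarrow> 'x" where
  "rep x = (SOME v. v \<in> V \<and> (\<exists>g\<in>carrier G. x = \<phi> g v))"

text \<open>Determined only up to the stabilizer of \<open>rep x\<close>; characters trivial on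
  stabilizers do not see the choice.\<close>

definition sec :: "'x \<Rightarrow> 'g" where
  "sec x = (SOME g. g \<in> carrier G \<and> x = \<phi> g (rep x))"

lemma rep_sec: "rep x \<in> V" "sec x \<in> carrier G" "\<phi> (sec x) (rep x) = x"
proof -
  have "\<exists>v. v \<in> V \<and> (\<exists>g\<in>carrier G. x = \<phi> g v)" using V(2) by blast
  from someI_ex[OF this] have *: "rep x \<in> V" "\<exists>g. g \<in> carrier G \<and> x = \<phi> g (rep x)"
    unfolding rep_def by blast+
  show "rep x \<in> V" by fact
  show "sec x \<in> carrier G" "\<phi> (sec x) (rep x) = x"
    using someI_ex[OF *(2)] unfolding sec_def by auto
qed

lemma rep_act:
  assumes g: "g \<in> carrier G" shows "rep (\<phi> g x) = rep x"
proof -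
  have "(\<exists>h\<in>carrier G. \<phi> g x = \<phi> h v) \<longleftrightarrow> (\<exists>h\<in>carrier G. x = \<phi> h v)" for v
  proof
    assume "\<exists>h\<in>carrier G. \<phi> g x = \<phi> h v"
    then obtain h where h: "h \<in> carrier G" "\<phi> g x = \<phi> h v" by blast
    then have "x = \<phi> (inv\<^bsub>G\<^esub> g \<otimes>\<^bsub>G\<^esub> h) v" using g act_inv(1)[OF g, of x] by (simp add: act_mult)
    then show "\<exists>h\<in>carrier G. x = \<phi> h v" using g h by blast
  next
    assume "\<exists>h\<in>carrier G. x = \<phi> h v"
    then obtain h where "h \<in> carrier G" "x = \<phi> h v" by blast
    then show "\<exists>h\<in>carrier G. \<phi> g x = \<phi> h v" using g act_mult[of g h v] by (intro bexI[of _ "g \<otimes>\<^bsub>G\<^esub> h"]) auto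
  qed
  then show ?thesis by (simp add: rep_def)
qed

lemma invariant_from_V:
  assumes "\<And>g x. g \<in> carrier G \<Longrightarrow> P x \<Longrightarrow> P (\<phi> g x)" "\<And>v. v \<in> V \<Longrightarrow> P v"
  shows "P x"
  using assms(1)[OF rep_sec(2) assms(2)[OF rep_sec(1)], of x x] by (simp add: rep_sec)

subsection \<open>Equivariant functions and Harnack's inequality\<close>

text \<open>The character is stored through its logarithm, so that characters can be added and
  scaled.\<close>

definition equi :: "('g \<Rightarrow> real) \<Rightarrow> ('x \<Rightarrow> real) \<Rightarrow> bool" where
  "equi \<alpha> h \<longleftrightarrow> (\<forall>g\<in>carrier G. \<forall>x. h (\<phi> g x) = exp (\<alpha> g) * h x)"

lemma equiD: "equi \<alpha> h \<Longrightarrow> g \<in> carrier G \<Longrightarrow> h (\<phi> g x) = exp (\<alpha> g) * h x"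
  by (simp add: equi_def)

lemma equi_H: "equi \<alpha> h \<Longrightarrow> equi \<alpha> (H h)"
  unfolding equi_def by (simp add: H_act H_scale)

lemma equi_scale: "equi \<alpha> h \<Longrightarrow> equi \<alpha> (\<lambda>x. k * h x)"
  unfolding equi_def by simp

definition supersol :: "real \<Rightarrow> ('x \<Rightarrow> real) set" where
  "supersol \<mu> = {h. h x0 = 1 \<and> (\<forall>x. 0 \<le> h x) \<and> (\<forall>x. \<mu> * h x \<le> H h x)}"

text \<open>For a supersolution a single term \<open>b y z * h z\<close> is at most the whole sum,
  which is at most \<open>(diag y - \<mu>) * h y\<close>. Iteration along a directed path gives a
  constant that does not depend on \<open>h\<close>.\<close>

lemma harnack: "\<exists>C\<ge>0. \<forall>h\<in>supersol \<mu>. h y \<le> C * h x"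
proof (rule path_induct[where P = "\<lambda>y. \<exists>C\<ge>0. \<forall>h\<in>supersol \<mu>. h y \<le> C * h x"])
  show "\<exists>C\<ge>0. \<forall>h\<in>supersol \<mu>. h x \<le> C * h x" by (intro exI[of _ 1]) auto
next
  fix y z assume "\<exists>C\<ge>0. \<forall>h\<in>supersol \<mu>. h y \<le> C * h x" and b: "0 < b y z"
  then obtain C where C: "0 \<le> C" "\<And>h. h \<in> supersol \<mu> \<Longrightarrow> h y \<le> C * h x" by blast
  define k where "k = \<bar>diag y - \<mu>\<bar> / b y z"
  have k: "0 \<le> k" using b by (simp add: k_def)
  have "h z \<le> k * C * h x" if h: "h \<in> supersol \<mu>" for h
  proof -
    have nn: "\<And>x. 0 \<le> h x" and sup: "\<mu> * h y \<le> H h y" using h by (auto simp: supersol_def)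
    have "b y z * h z \<le> (\<Sum>z\<in>nb y. b y z * h z)"
      using b by (intro member_le_sum finite_nb) (auto simp: b_nonneg nn nb_def)
    also have "\<dots> \<le> (diag y - \<mu>) * h y" using sup by (simp add: H_eq algebra_simps)
    also have "\<dots> \<le> \<bar>diag y - \<mu>\<bar> * h y" using nn by (intro mult_right_mono) auto
    finally have "h z \<le> k * h y" using b by (simp add: k_def field_simps)
    also have "\<dots> \<le> k * (C * h x)" using C(2)[OF h] k by (intro mult_left_mono)
    finally show ?thesis by simp
  qed
  then show "\<exists>C\<ge>0. \<forall>h\<in>supersol \<mu>. h z \<le> C * h x"
    using k C(1) by (intro exI[of _ "k * C"]) auto
qed

text \<open>Harnack from \<open>x\<close> to \<open>x0\<close>: the normalization
  \<open>h x0 = 1\<close> excludes a zero at \<open>x\<close>.\<close>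

lemma supersol_pos:
  assumes "h \<in> supersol \<mu>" shows "0 < h x"
proof -
  obtain C where "h x0 \<le> C * h x" using harnack[of \<mu> x0 x] assms by blast
  then have "1 \<le> C * h x" using assms by (simp add: supersol_def)
  moreover have "0 \<le> h x" using assms by (simp add: supersol_def)
  ultimately show ?thesis by (cases "h x = 0") auto
qed

lemma compact_supersol: "compact (supersol \<mu>)"
proof -
  have "\<exists>C. \<forall>y. \<forall>h\<in>supersol \<mu>. h y \<le> C y * h x0"
    using harnack[of \<mu> _ x0] by metis
  then obtain C where C: "\<And>y h. h \<in> supersol \<mu> \<Longrightarrow> h y \<le> C y * h x0" by blast
  have "closed (supersol \<mu>)"
    unfolding supersol_def
    by (intro closed_Collect_conj closed_Collect_all closed_Collect_eq closed_Collect_le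
        continuous_on_H continuous_intros continuous_on_product_coordinates)
  moreover have "supersol \<mu> \<subseteq> {h. \<forall>x. h x \<in> {0..C x}}"
    using C by (fastforce simp: supersol_def)
  ultimately show ?thesis
    using closed_Int_compact[OF _ compact_box[of C], of "supersol \<mu>"] by (simp add: Int_absorb2)
qed

subsection \<open>Uniqueness and existence of positive equivariant eigenfunctions\<close>

text \<open>The quotient \<open>h / f\<close> is invariant, so it attains its minimum
  \<open>k\<close> on \<open>V\<close>, and \<open>w = h - k * f\<close> is nonnegative with a zero.
  The minimum principle there gives \<open>\<mu> \<le> l\<close>; for \<open>\<mu> = l\<close> the
  zero spreads along edges to the whole graph.\<close>

lemma eigenvalue_maximal:
  assumes f: "equi \<alpha> f" "\<And>x. 0 < f x" "\<And>x. H f x = l * f x"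
    and h: "equi \<alpha> h" "\<And>x. 0 < h x" "\<And>x. \<mu> * h x \<le> H h x"
  shows "\<mu> \<le> l" and "\<mu> = l \<Longrightarrow> \<exists>k. \<forall>x. h x = k * f x"
proof -
  have "V \<noteq> {}" using rep_sec(1) by blast
  then obtain x where x: "x \<in> V" "\<And>v. v \<in> V \<Longrightarrow> h x / f x \<le> h v / f v"
    using finite_has_minimal[of "(\<lambda>v. h v / f v) ` V"] V(1)
    by (smt (verit) arg_min_if_finite(1) arg_min_least)
  define k where "k = h x / f x"
  have min: "k \<le> h y / f y" for y
  proof (rule invariant_from_V)
    show "k \<le> h (\<phi> g y) / f (\<phi> g y)" if "g \<in> carrier G" "k \<le> h y / f y" for g y
      using that f h by (simp add: equiD)
  qed (use x in \<open>simp add: k_def\<close>)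
  define w where "w y = h y - k * f y" for y
  have w: "0 \<le> w y" for y using min[of y] f(2)[of y] by (simp add: w_def field_simps)
  have wx: "w x = 0" using f(2)[of x] by (simp add: w_def k_def)
  have Hw: "(\<mu> - l) * h y + l * w y \<le> H w y" for y
    using h(3)[of y] unfolding w_def by (simp add: H_diff f(3) algebra_simps)
  have "(\<mu> - l) * h x \<le> 0"
    using Hw[of x] H_le_at_zero[of w x x] w wx by simp
  then show "\<mu> \<le> l" using h(2)[of x] by (simp add: mult_le_0_iff)
  assume eq: "\<mu> = l"
  have "w y = 0" for y
  proof (rule path_induct[of "\<lambda>y. w y = 0", OF wx])
    fix y z assume y: "w y = 0" and b: "0 < b y z"
    then have "0 \<le> - b y z * w z"
      using Hw[of y] H_le_at_zero[of w y z] w eq by simp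
    then have "w z \<le> 0" using b by (simp add: mult_le_0_iff zero_le_mult_iff)
    then show "w z = 0" using w[of z] by simp
  qed
  then show "\<exists>k. \<forall>x. h x = k * f x" by (intro exI[of _ k]) (simp add: w_def)
qed

text \<open>The character of a positive multiplicative function is trivial on point stabilizers.\<close>

definition logchars :: "('g \<Rightarrow> real) set" where
  "logchars = {\<alpha>. (\<forall>g. g \<notin> carrier G \<longrightarrow> \<alpha> g = 0) \<and>
     (\<forall>g\<in>carrier G. \<forall>h\<in>carrier G. \<alpha> (g \<otimes>\<^bsub>G\<^esub> h) = \<alpha> g + \<alpha> h) \<and>
     (\<forall>g\<in>carrier G. \<forall>x. \<phi> g x = x \<longrightarrow> \<alpha> g = 0)}"

lemma logcharsD:
  assumes "\<alpha> \<in> logchars"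
  shows "g \<in> carrier G \<Longrightarrow> h \<in> carrier G \<Longrightarrow> \<alpha> (g \<otimes>\<^bsub>G\<^esub> h) = \<alpha> g + \<alpha> h"
    and "g \<in> carrier G \<Longrightarrow> \<phi> g x = x \<Longrightarrow> \<alpha> g = 0"
  using assms unfolding logchars_def by blast+

lemma logchars_inv:
  assumes "\<alpha> \<in> logchars" "g \<in> carrier G" shows "\<alpha> (inv\<^bsub>G\<^esub> g) = - \<alpha> g"
proof -
  have "\<alpha> (inv\<^bsub>G\<^esub> g \<otimes>\<^bsub>G\<^esub> g) = \<alpha> (inv\<^bsub>G\<^esub> g) + \<alpha> g"
    by (rule logcharsD(1)[OF assms(1) G.inv_closed[OF assms(2)] assms(2)])
  moreover have "\<alpha> \<one>\<^bsub>G\<^esub> = 0" using logcharsD(2)[OF assms(1) G.one_closed act_one] .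
  ultimately show ?thesis using assms by simp
qed

text \<open>\<open>sec (\<phi> g x)\<close> and \<open>g \<otimes> sec x\<close> send
  \<open>rep x\<close> to the same point, so they differ by a stabilizer element, on which
  \<open>\<alpha>\<close> vanishes.\<close>

lemma sec_act:
  assumes \<alpha>: "\<alpha> \<in> logchars" and g: "g \<in> carrier G"
  shows "\<alpha> (sec (\<phi> g x)) = \<alpha> g + \<alpha> (sec x)"
proof -
  let ?k = "g \<otimes>\<^bsub>G\<^esub> sec x" and ?s = "sec (\<phi> g x)"
  have k: "?k \<in> carrier G" and s: "?s \<in> carrier G" using g rep_sec by auto
  have "\<phi> ?s (rep x) = \<phi> ?k (rep x)"
    using rep_sec(3)[of "\<phi> g x"] rep_act[OF g, of x] rep_sec[of x] g by (simp add: act_mult)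
  then have "\<phi> (inv\<^bsub>G\<^esub> ?k \<otimes>\<^bsub>G\<^esub> ?s) (rep x) = rep x"
    unfolding act_mult[OF G.inv_closed[OF k] s] by (simp only: act_inv(1)[OF k])
  then have "\<alpha> (inv\<^bsub>G\<^esub> ?k \<otimes>\<^bsub>G\<^esub> ?s) = 0"
    by (rule logcharsD(2)[OF \<alpha> G.m_closed[OF G.inv_closed[OF k] s]])
  moreover have "\<alpha> (inv\<^bsub>G\<^esub> ?k \<otimes>\<^bsub>G\<^esub> ?s) = \<alpha> (inv\<^bsub>G\<^esub> ?k) + \<alpha> ?s"
    by (rule logcharsD(1)[OF \<alpha> G.inv_closed[OF k] s])
  moreover have "\<alpha> ?k = \<alpha> g + \<alpha> (sec x)" by (rule logcharsD(1)[OF \<alpha> g rep_sec(2)])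
  ultimately show ?thesis using logchars_inv[OF \<alpha> k] by simp
qed

section \<open>Existence through extremal supersolutions\<close>

definition strict_set :: "real \<Rightarrow> ('x \<Rightarrow> real) \<Rightarrow> 'x set" where
  "strict_set \<mu> h = {x. \<mu> * h x < H h x}"

lemma strict_set_act:
  assumes "equi \<alpha> h" "g \<in> carrier G"
  shows "\<phi> g x \<in> strict_set \<mu> h \<longleftrightarrow> x \<in> strict_set \<mu> h"
proof -
  have "\<phi> g x \<in> strict_set \<mu> h \<longleftrightarrow> exp (\<alpha> g) * (\<mu> * h x) < exp (\<alpha> g) * H h x"
    using equiD[OF assms] equiD[OF equi_H[OF assms(1)] assms(2)] by (simp add: strict_set_def algebra_simps)
  then show ?thesis by (simp add: strict_set_def)
qed

lemma strict_set_rep: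
  assumes "equi \<alpha> h" shows "rep x \<in> strict_set \<mu> h \<longleftrightarrow> x \<in> strict_set \<mu> h"
  using strict_set_act[OF assms rep_sec(2)[of x], of "rep x"] by (simp add: rep_sec)

text \<open>Lower \<open>h\<close> slightly on its strict set \<open>W\<close>. Off
  \<open>W\<close>, lower values at neighbours can only raise \<open>H\<close>, with a strict gain
  at a point having an edge into \<open>W\<close>. On \<open>W\<close>, a small
  \<open>\<epsilon>\<close> preserves strictness, since by invariance only the points of
  \<open>V\<close> need checking.\<close>

lemma enlarge_strict_set:
  assumes h: "h \<in> supersol \<mu>" "equi \<alpha> h"
    and ne: "strict_set \<mu> h \<noteq> {}" "strict_set \<mu> h \<noteq> UNIV"
  shows "\<exists>h'\<in>supersol \<mu>. equi \<alpha> h' \<and> card (strict_set \<mu> h \<inter> V) < card (strict_set \<mu> h' \<inter> V)"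
proof -
  let ?W = "strict_set \<mu> h"
  have pos: "0 < h x" for x using supersol_pos[OF h(1)] .
  \<comment> \<open>Connectivity supplies an edge from outside the strict set into it.\<close>
  obtain x y where xy: "x \<notin> ?W" "y \<in> ?W" "0 < b x y"
  proof (rule ccontr)
    assume "\<not> thesis"
    then have closed: "y \<notin> ?W" if "x \<notin> ?W" "0 < b x y" for x y using that \<open>\<And>y x. x \<notin> ?W \<Longrightarrow> y \<in> ?W \<Longrightarrow> 0 < b x y \<Longrightarrow> thesis\<close> by blast
    obtain x where "x \<notin> ?W" using ne by blast
    then have "y \<notin> ?W" for y using path_induct[of "\<lambda>y. y \<notin> ?W" x y] closed by blast
    then show False using ne by blast
  qed
  define w where "w x = (if x \<in> ?W then h x else 0)" for x
  have w0: "0 \<le> w x" for x using pos[of x] by (simp add: w_def)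
  have w_equi: "equi \<alpha> w"
    using h(2) strict_set_act[OF h(2)] by (auto simp: equi_def w_def)
  obtain \<epsilon> where \<epsilon>: "0 < \<epsilon>" "\<epsilon> < 1"
    and small: "\<And>z. z \<in> ?W \<inter> V \<Longrightarrow> \<epsilon> * (H w z - \<mu> * w z) < H h z - \<mu> * h z"
    by (rule small_multiplier[of "?W \<inter> V" "\<lambda>z. H h z - \<mu> * h z" "\<lambda>z. H w z - \<mu> * w z"])
       (use V in \<open>auto simp: strict_set_def\<close>)
  define k where "k z = h z - \<epsilon> * w z" for z
  have Hk: "H k z = H h z - \<epsilon> * H w z" for z
    unfolding k_def by (rule H_diff)
  have k_equi: "equi \<alpha> k"
    using h(2) w_equi by (simp add: equi_def k_def algebra_simps)
  have k_pos: "0 < k z" for z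
    using pos[of z] \<epsilon> by (simp add: k_def w_def)
  have W_sub: "z \<in> strict_set \<mu> k" if "z \<in> ?W" for z
  proof -
    have "rep z \<in> ?W \<inter> V" using that strict_set_rep[OF h(2)] rep_sec(1) by simp
    then have "rep z \<in> strict_set \<mu> k"
      using small[of "rep z"] by (simp add: strict_set_def Hk k_def algebra_simps)
    then show ?thesis using strict_set_rep[OF k_equi] by simp
  qed
  have sup: "\<mu> * k z \<le> H k z" for z
  proof (cases "z \<in> ?W")
    case True
    then show ?thesis using W_sub[of z] by (simp add: strict_set_def)
  next
    case False
    then have wz: "w z = 0" by (simp add: w_def)
    then have "\<epsilon> * H w z \<le> 0"
      using H_le_at_zero[of w z z] w0 \<epsilon> by (simp add: mult_le_0_iff)
    moreover have "\<mu> * h z \<le> H h z" using h(1) by (simp add: supersol_def)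
    ultimately show ?thesis using wz by (simp add: Hk k_def)
  qed
  have x_in: "x \<in> strict_set \<mu> k"
  proof -
    have wx: "w x = 0" using xy by (simp add: w_def)
    have "H w x \<le> - b x y * h y" using H_le_at_zero[of w x y] w0 wx xy by (simp add: w_def)
    also have "\<dots> < 0" using xy pos[of y] by simp
    finally have "\<epsilon> * H w x < 0" using \<epsilon> by (simp add: mult_less_0_iff)
    moreover have "\<mu> * h x \<le> H h x" using h(1) by (simp add: supersol_def)
    ultimately show ?thesis using wx by (simp add: strict_set_def Hk k_def)
  qed
  define h' where "h' z = 1 / k x0 * k z" for z
  have Hh': "H h' z = 1 / k x0 * H k z" for z unfolding h'_def by (rule H_scale)
  have "h' \<in> supersol \<mu>"
    unfolding supersol_def
  proof (intro CollectI conjI allI)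
    show "h' x0 = 1" using k_pos[of x0] by (simp add: h'_def)
    show "0 \<le> h' z" for z using k_pos[of z] k_pos[of x0] by (simp add: h'_def)
    show "\<mu> * h' z \<le> H h' z" for z
      using sup[of z] k_pos[of x0] by (simp add: Hh' h'_def divide_right_mono)
  qed
  moreover have "equi \<alpha> h'" unfolding h'_def by (rule equi_scale[OF k_equi])
  moreover have eq: "strict_set \<mu> h' = strict_set \<mu> k"
    using k_pos[of x0] by (simp add: strict_set_def Hh' h'_def divide_less_cancel)
  have "card (?W \<inter> V) < card (strict_set \<mu> h' \<inter> V)"
  proof (rule psubset_card_mono)
    have "rep x \<in> strict_set \<mu> k \<inter> V" "rep x \<notin> ?W"
      using x_in xy strict_set_rep[OF k_equi] strict_set_rep[OF h(2)] rep_sec(1) by auto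
    then show "?W \<inter> V \<subset> strict_set \<mu> h' \<inter> V" using W_sub eq by blast
  qed (use V in auto)
  ultimately show ?thesis by blast
qed

text \<open>Compactness attains the supremum of all \<open>\<mu>\<close> with an equivariant
  supersolution. Among the extremal supersolutions take one with the most strict points in
  \<open>V\<close>. Strictness everywhere would allow a larger \<open>\<mu>\<close>, and strictness
  only somewhere could be enlarged, so equality holds throughout.\<close>

lemma eigenfunction_exists:
  assumes \<alpha>: "\<alpha> \<in> logchars"
  shows "\<exists>f \<mu>. f x0 = 1 \<and> (\<forall>x. 0 < f x) \<and> equi \<alpha> f \<and> (\<forall>x. H f x = \<mu> * f x)"
proof -
  define S where "S \<mu> = {h \<in> supersol \<mu>. equi \<alpha> h}" for \<mu>
  have raise: "\<mu> \<le> \<mu>' \<Longrightarrow> S \<mu>' \<subseteq> S \<mu>" for \<mu> \<mu>'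
    by (auto simp: S_def supersol_def intro: order_trans[OF mult_right_mono])
  have improve: "\<exists>\<delta>>0. S (\<mu> + \<delta>) \<noteq> {}" if h: "h \<in> S \<mu>" and all: "strict_set \<mu> h = UNIV" for \<mu> h
  proof -
    have pos: "0 < h x" for x using h supersol_pos by (auto simp: S_def)
    have eq: "equi \<alpha> h" using h by (simp add: S_def)
    \<comment> \<open>Invariance reduces the gap to the finite set \<open>V\<close>, where it has a
      uniform relative size.\<close>
    obtain \<delta> where \<delta>: "0 < \<delta>" "\<And>z. z \<in> V \<Longrightarrow> \<delta> * h z < H h z - \<mu> * h z"
      by (rule small_multiplier[of V "\<lambda>z. H h z - \<mu> * h z" h])
         (use V all in \<open>auto simp: strict_set_def\<close>)
    have "x \<in> strict_set (\<mu> + \<delta>) h" for x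
      using strict_set_rep[OF eq, of x "\<mu> + \<delta>"] \<delta>(2)[OF rep_sec(1)[of x]]
      by (simp add: strict_set_def algebra_simps)
    then have "h \<in> S (\<mu> + \<delta>)"
      using h by (auto simp: S_def supersol_def strict_set_def intro: less_imp_le)
    then show ?thesis using \<delta>(1) by blast
  qed
  define T where "T = {\<mu>. S \<mu> \<noteq> {}}"
  have "T \<noteq> {}"
  proof -
    \<comment> \<open>The section turns the character into a positive equivariant function;
      \<open>\<mu>\<close> is then put below all ratios \<open>H k / k\<close> on
      \<open>V\<close>.\<close>
    define k where "k x = 1 / exp (\<alpha> (sec x0)) * exp (\<alpha> (sec x))" for x
    have k_equi: "equi \<alpha> k" by (simp add: equi_def k_def sec_act[OF \<alpha>] exp_add)
    have k_pos: "0 < k x" for x by (simp add: k_def)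
    define \<mu> where "\<mu> = - (\<Sum>v\<in>V. \<bar>H k v / k v\<bar>) - 1"
    have "v \<in> strict_set \<mu> k" if "v \<in> V" for v
    proof -
      have "\<bar>H k v / k v\<bar> \<le> (\<Sum>v\<in>V. \<bar>H k v / k v\<bar>)"
        using that V by (intro member_le_sum) auto
      then have "\<mu> < H k v / k v" unfolding \<mu>_def by linarith
      then show ?thesis using k_pos[of v] by (simp add: strict_set_def field_simps)
    qed
    then have "x \<in> strict_set \<mu> k" for x
      using strict_set_rep[OF k_equi, of x \<mu>] rep_sec(1)[of x] by blast
    then have "k \<in> S \<mu>"
      using k_equi k_pos by (auto simp: S_def supersol_def strict_set_def less_imp_le) (simp add: k_def)
    then show ?thesis by (auto simp: T_def)
  qed
  moreover have "bdd_above T"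
  proof (rule bdd_aboveI)
    fix \<mu> assume "\<mu> \<in> T"
    then obtain h where h: "h \<in> supersol \<mu>" by (auto simp: T_def S_def)
    have "0 \<le> (\<Sum>y\<in>nb x0. b x0 y * h y)"
      using h by (intro sum_nonneg) (simp add: b_nonneg supersol_def)
    moreover have "\<mu> * h x0 \<le> H h x0" "h x0 = 1" using h unfolding supersol_def by blast+
    ultimately show "\<mu> \<le> diag x0" by (simp add: H_eq)
  qed
  ultimately have sup: "\<mu> \<in> T \<Longrightarrow> \<mu> \<le> Sup T" "\<mu> < Sup T \<Longrightarrow> \<exists>\<mu>'\<in>T. \<mu> < \<mu>'" for \<mu>
    by (auto intro: cSup_upper simp: less_cSup_iff)
  have compactS: "compact (S \<mu>)" for \<mu>
  proof -
    have "closed {h. equi \<alpha> h}" unfolding equi_def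
      by (intro closed_Collect_ball closed_Collect_all closed_Collect_eq continuous_intros
          continuous_on_product_coordinates)
    then show ?thesis unfolding S_def
      using compact_Int_closed[OF compact_supersol[of \<mu>]] by (simp add: Collect_conj_eq)
  qed
  \<comment> \<open>The sets \<open>S \<mu>\<close> decrease in \<open>\<mu>\<close>, so each finite
    intersection contains a nonempty one; \<open>S (Sup T - 1)\<close> provides the compact set to
    intersect in.\<close>
  have "S (Sup T - 1) \<inter> \<Inter> (S ` {..<Sup T}) \<noteq> {}"
  proof (rule compact_imp_fip_image[OF compactS compact_imp_closed[OF compactS]])
    fix I assume I: "finite I" "I \<subseteq> {..<Sup T}"
    define \<mu> where "\<mu> = Max (insert (Sup T - 1) I)"
    have "\<mu> < Sup T" using I by (auto simp: \<mu>_def)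
    then obtain \<mu>' where \<mu>': "\<mu>' \<in> T" "\<mu> < \<mu>'" using sup(2) by blast
    have "\<nu> \<le> \<mu>'" if "\<nu> \<in> insert (Sup T - 1) I" for \<nu>
      using Max_ge[of "insert (Sup T - 1) I" \<nu>] that I \<mu>' unfolding \<mu>_def by auto
    then have "S \<mu>' \<subseteq> S (Sup T - 1) \<inter> \<Inter> (S ` I)"
      using raise by (intro Int_greatest INF_greatest) auto
    moreover have "S \<mu>' \<noteq> {}" using \<mu>'(1) unfolding T_def by simp
    ultimately show "S (Sup T - 1) \<inter> \<Inter> (S ` I) \<noteq> {}" by blast
  qed
  then obtain h1 where h1: "\<And>\<mu>. \<mu> < Sup T \<Longrightarrow> h1 \<in> S \<mu>" by blast
  have "h1 \<in> S (Sup T)"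
  proof -
    have *: "h1 \<in> supersol (Sup T - 1)" "equi \<alpha> h1" using h1[of "Sup T - 1"] by (auto simp: S_def)
    have "Sup T * h1 x \<le> H h1 x" for x
    proof (rule ccontr)
      assume "\<not> Sup T * h1 x \<le> H h1 x"
      then have "H h1 x / h1 x < Sup T" using supersol_pos[OF *(1), of x] by (simp add: field_simps)
      then obtain \<mu> where \<mu>: "H h1 x / h1 x < \<mu>" "\<mu> < Sup T" using dense by blast
      have "\<mu> * h1 x \<le> H h1 x" using h1[OF \<mu>(2)] by (simp add: S_def supersol_def)
      then show False using \<mu> supersol_pos[OF *(1), of x] by (simp add: field_simps)
    qed
    then show ?thesis using * by (simp add: S_def supersol_def)
  qed
  then obtain h where h: "h \<in> S (Sup T)"
    and max: "\<And>h'. h' \<in> S (Sup T) \<Longrightarrow> card (strict_set (Sup T) h' \<inter> V) \<le> card (strict_set (Sup T) h \<inter> V)"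
    using ex_has_greatest_nat[of "\<lambda>h. h \<in> S (Sup T)" h1 "\<lambda>h. card (strict_set (Sup T) h \<inter> V)" "Suc (card V)"]
      card_mono[OF V(1)] by (auto simp: le_imp_less_Suc less_imp_le)
  have "strict_set (Sup T) h \<noteq> UNIV"
    using improve[OF h] sup(1) by (force simp: T_def)
  moreover have "strict_set (Sup T) h = {} \<or> strict_set (Sup T) h = UNIV"
    using enlarge_strict_set[of h "Sup T" \<alpha>] h max by (force simp: S_def)
  ultimately have empty: "strict_set (Sup T) h = {}" by blast
  have "H h x = Sup T * h x" for x
  proof (rule antisym)
    show "H h x \<le> Sup T * h x" using empty by (auto simp: strict_set_def not_less)
    show "Sup T * h x \<le> H h x" using h unfolding S_def supersol_def by blast
  qed
  then show ?thesis
    using h supersol_pos[of h "Sup T"] unfolding S_def supersol_def by blast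
qed

subsection \<open>Multiplicative eigenfunctions\<close>

text \<open>Character and eigenvalue are expressed through \<open>f\<close> instead of being
  quantified, so every condition except positivity is closed under pointwise limits.\<close>

definition eigenfuns :: "('x \<Rightarrow> real) set" where
  "eigenfuns = {f. f x0 = 1 \<and> (\<forall>x. 0 < f x) \<and>
     (\<forall>g\<in>carrier G. \<forall>x. f (\<phi> g x) = f (\<phi> g x0) * f x) \<and> (\<forall>x. H f x = H f x0 * f x)}"

lemma eigenfunsD:
  assumes "f \<in> eigenfuns"
  shows "f x0 = 1" "0 < f x" "g \<in> carrier G \<Longrightarrow> f (\<phi> g x) = f (\<phi> g x0) * f x"
    "H f x = H f x0 * f x"
  using assms unfolding eigenfuns_def by blast+

text \<open>The conditions pass to pointwise limits because \<open>H\<close> is a finite sum, so the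
  closure adds nothing; \<open>f \<noteq> 0\<close> follows from \<open>f x0 = 1\<close>.\<close>

lemma Kset_eq: "Kset b c x0 l = {f. f x0 = 1 \<and> (\<forall>x. 0 \<le> f x) \<and> (\<forall>x. H f x = l * f x)}"
proof -
  have "{f. (\<forall>x. 0 \<le> f x) \<and> f \<noteq> (\<lambda>_. 0) \<and> harmonic_at b c l f \<and> f x0 = 1} =
    {f. f x0 = 1 \<and> (\<forall>x. 0 \<le> f x) \<and> (\<forall>x. H f x = l * f x)}"
    using in_domH by (auto simp: harmonic_at_def)
  moreover have "closed {f. f x0 = 1 \<and> (\<forall>x. 0 \<le> f x) \<and> (\<forall>x. H f x = l * f x)}"
    by (intro closed_Collect_conj closed_Collect_all closed_Collect_eq closed_Collect_le
        continuous_on_H continuous_intros continuous_on_product_coordinates)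
  ultimately show ?thesis by (simp add: Kset_def closure_closed)
qed

lemma multiplicative_iff:
  assumes "f x0 = 1" "\<And>x. 0 < f x"
  shows "multiplicative G \<phi> f \<longleftrightarrow> (\<forall>g\<in>carrier G. \<forall>x. f (\<phi> g x) = f (\<phi> g x0) * f x)"
proof
  assume "multiplicative G \<phi> f"
  then obtain \<gamma> where \<gamma>: "\<And>g. g \<in> carrier G \<Longrightarrow> Tg \<phi> G g f = (\<lambda>x. \<gamma> (inv\<^bsub>G\<^esub> g) * f x)"
    unfolding multiplicative_def by blast
  have "f (\<phi> g x) = \<gamma> g * f x" if "g \<in> carrier G" for g x
    using fun_cong[OF \<gamma>[of "inv\<^bsub>G\<^esub> g"], of x] that by (simp add: Tg_def)
  then show "\<forall>g\<in>carrier G. \<forall>x. f (\<phi> g x) = f (\<phi> g x0) * f x" using assms(1) by simp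
next
  assume mult: "\<forall>g\<in>carrier G. \<forall>x. f (\<phi> g x) = f (\<phi> g x0) * f x"
  then have T: "Tg \<phi> G g f = (\<lambda>x. f (\<phi> (inv\<^bsub>G\<^esub> g) x0) * f x)" if "g \<in> carrier G" for g
    unfolding Tg_def by (rule_tac ext) (use G.inv_closed[OF that] in blast)
  show "multiplicative G \<phi> f"
    unfolding multiplicative_def
  proof (intro exI[of _ "\<lambda>g. f (\<phi> g x0)"] conjI ballI)
    show "f (\<phi> (g \<otimes>\<^bsub>G\<^esub> h) x0) = f (\<phi> g x0) * f (\<phi> h x0)" if "g \<in> carrier G" "h \<in> carrier G" for g h
      unfolding act_mult[OF that] using mult that(1) by blast
  qed (use assms(2) T in blast)+
qed

text \<open>An element of \<open>Kset\<close> is a supersolution for its own eigenvalue, so Harnack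
  upgrades nonnegativity to positivity.\<close>

lemma Mset_eq: "Mset G \<phi> b c x0 I = {f \<in> eigenfuns. H f x0 \<in> I}"
proof (intro equalityI subsetI)
  fix f assume "f \<in> Mset G \<phi> b c x0 I"
  then obtain l where l: "l \<in> I" "f \<in> Kset b c x0 l" "multiplicative G \<phi> f"
    by (auto simp: Mset_def)
  then have f: "f x0 = 1" "\<And>x. 0 \<le> f x" "\<And>x. H f x = l * f x" by (auto simp: Kset_eq)
  then have "f \<in> supersol l" by (simp add: supersol_def)
  then have pos: "\<And>x. 0 < f x" by (rule supersol_pos)
  have Hx0: "H f x0 = l" using f by simp
  have "\<forall>x. H f x = H f x0 * f x" using f(3) Hx0 by simp
  moreover have "\<forall>g\<in>carrier G. \<forall>x. f (\<phi> g x) = f (\<phi> g x0) * f x"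
    by (rule iffD1[OF multiplicative_iff l(3)]) (use f(1) pos in auto)
  ultimately have "f \<in> eigenfuns" using f(1) pos unfolding eigenfuns_def by blast
  then show "f \<in> {f \<in> eigenfuns. H f x0 \<in> I}" using l Hx0 by simp
next
  fix f assume "f \<in> {f \<in> eigenfuns. H f x0 \<in> I}"
  then have f: "f \<in> eigenfuns" "H f x0 \<in> I" by auto
  note D = eigenfunsD[OF f(1)]
  have "f \<in> Kset b c x0 (H f x0)"
    unfolding Kset_eq using D(1) less_imp_le[OF D(2)] D(4) by blast
  moreover have "multiplicative G \<phi> f"
    by (rule iffD2[OF multiplicative_iff]) (use D(1-3) in blast)+
  ultimately show "f \<in> Mset G \<phi> b c x0 I" using f unfolding Mset_def by blast
qed

text \<open>An eigenvalue at least \<open>r\<close> makes \<open>f\<close> a supersolution at level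
  \<open>r\<close>, so all these functions lie in one compact set. Positivity, the one condition
  that is not closed, is restored by Harnack.\<close>

lemma compact_eigenfuns_superlevel: "compact {f \<in> eigenfuns. r \<le> H f x0}"
proof -
  have "{f \<in> eigenfuns. r \<le> H f x0} = supersol r \<inter> {f. r \<le> H f x0 \<and>
    (\<forall>g\<in>carrier G. \<forall>x. f (\<phi> g x) = f (\<phi> g x0) * f x) \<and> (\<forall>x. H f x = H f x0 * f x)}"
    (is "?L = ?R")
  proof (intro equalityI subsetI)
    fix f assume "f \<in> ?L"
    then have f: "f \<in> eigenfuns" "r \<le> H f x0" by auto
    note D = eigenfunsD[OF f(1)]
    have "r * f x \<le> H f x" for x
      unfolding D(4)[of x] using f(2) less_imp_le[OF D(2)] by (rule mult_right_mono)
    then have "f \<in> supersol r" unfolding supersol_def using D(1) less_imp_le[OF D(2)] by blast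
    then show "f \<in> ?R" using f(2) D(3,4) by blast
  next
    fix f assume f: "f \<in> ?R"
    then have "f \<in> supersol r" by blast
    then show "f \<in> ?L" using supersol_pos[of f r] f unfolding eigenfuns_def supersol_def by blast
  qed
  moreover have "closed {f. r \<le> H f x0 \<and>
    (\<forall>g\<in>carrier G. \<forall>x. f (\<phi> g x) = f (\<phi> g x0) * f x) \<and> (\<forall>x. H f x = H f x0 * f x)}"
    by (intro closed_Collect_conj closed_Collect_ball closed_Collect_all closed_Collect_eq closed_Collect_le
        continuous_on_H continuous_intros continuous_on_product_coordinates)
  ultimately show ?thesis using compact_Int_closed[OF compact_supersol] by simp
qed

text \<open>The value 0 off the carrier matches \<open>logchars\<close>, so that equal characters
  are equal functions.\<close>

definition logof :: "('x \<Rightarrow> real) \<Rightarrow> 'g \<Rightarrow> real" where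
  "logof f g = (if g \<in> carrier G then ln (f (\<phi> g x0)) else 0)"

lemma logof_logchars:
  assumes "f \<in> eigenfuns" shows "logof f \<in> logchars"
proof -
  have f: "\<And>x. 0 < f x" "\<And>g x. g \<in> carrier G \<Longrightarrow> f (\<phi> g x) = f (\<phi> g x0) * f x"
    using eigenfunsD[OF assms] by blast+
  have "f (\<phi> g x0) = 1" if "g \<in> carrier G" "\<phi> g x = x" for g x
    using f(2)[OF that(1), of x] f(1)[of x] that by simp
  moreover have "ln (f (\<phi> (g \<otimes>\<^bsub>G\<^esub> h) x0)) = ln (f (\<phi> g x0)) + ln (f (\<phi> h x0))"
    if "g \<in> carrier G" "h \<in> carrier G" for g h
    using that f(2)[of g "\<phi> h x0"] f(1)[of "\<phi> g x0"] f(1)[of "\<phi> h x0"] by (simp add: act_mult ln_mult)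
  ultimately show ?thesis by (auto simp: logchars_def logof_def)
qed

lemma equi_logof: "f \<in> eigenfuns \<Longrightarrow> equi (logof f) f"
  unfolding equi_def logof_def using eigenfunsD(2,3) by simp

lemma eigenfunsI:
  assumes "\<alpha> \<in> logchars" "f x0 = 1" "\<And>x. 0 < f x" "equi \<alpha> f" "\<And>x. H f x = \<mu> * f x"
  shows "f \<in> eigenfuns" "logof f = \<alpha>" "H f x0 = \<mu>"
proof -
  show \<mu>: "H f x0 = \<mu>" using assms by simp
  have f: "f (\<phi> g x) = exp (\<alpha> g) * f x" if "g \<in> carrier G" for g x
    using equiD[OF assms(4) that] .
  show "f \<in> eigenfuns"
    unfolding eigenfuns_def \<mu> using assms by (auto simp: f)
  show "logof f = \<alpha>"
    using assms(1,2) f by (auto simp: logof_def logchars_def)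
qed

text \<open>\<open>eigenvalue_maximal\<close> in both directions gives equal eigenvalues, then
  proportionality; the values at \<open>x0\<close> fix the factor.\<close>

lemma eigenfuns_eqI:
  assumes f: "f \<in> eigenfuns" and f': "f' \<in> eigenfuns" and eq: "logof f = logof f'"
  shows "f = f'"
proof -
  have 1: "equi (logof f) f" "\<And>x. 0 < f x" "\<And>x. H f x = H f x0 * f x" "f x0 = 1"
    using equi_logof[OF f] eigenfunsD[OF f] by blast+
  have 2: "equi (logof f) f'" "\<And>x. 0 < f' x" "\<And>x. H f' x = H f' x0 * f' x" "f' x0 = 1"
    using equi_logof[OF f'] eigenfunsD[OF f'] unfolding eq by blast+
  have "H f x0 \<le> H f' x0"
    by (rule eigenvalue_maximal(1)[OF 2(1-3) 1(1,2)]) (rule eq_refl[OF 1(3)[symmetric]])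
  moreover have "H f' x0 \<le> H f x0"
    by (rule eigenvalue_maximal(1)[OF 1(1-3) 2(1,2)]) (rule eq_refl[OF 2(3)[symmetric]])
  ultimately have eq': "H f' x0 = H f x0" by simp
  have "\<exists>k. \<forall>x. f' x = k * f x"
    by (rule eigenvalue_maximal(2)[OF 1(1-3) 2(1,2) _ eq']) (rule eq_refl[OF 2(3)[symmetric]])
  then obtain k where k: "\<And>x. f' x = k * f x" by blast
  then have "k = 1" using k[of x0] 1 2 by simp
  then show ?thesis using k by auto
qed

section \<open>Logarithmic characters and concavity of the eigenvalue\<close>

lemma logchars_zero: "(\<lambda>_. 0) \<in> logchars"
  by (simp add: logchars_def)

lemma logchars_add: "\<alpha> \<in> logchars \<Longrightarrow> \<beta> \<in> logchars \<Longrightarrow> (\<lambda>g. \<alpha> g + \<beta> g) \<in> logchars"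
  by (auto simp: logchars_def)

lemma logchars_scale: "\<alpha> \<in> logchars \<Longrightarrow> (\<lambda>g. r * \<alpha> g) \<in> logchars"
  by (auto simp: logchars_def algebra_simps)

text \<open>The weighted geometric mean of two eigenfunctions is a supersolution for the weighted
  arithmetic mean of the eigenvalues, by the AM-GM inequality on each edge.\<close>

lemma eigenvalue_strict_concave:
  assumes f1: "f1 \<in> eigenfuns" and f2: "f2 \<in> eigenfuns" and "f1 \<noteq> f2" and t: "0 < t" "t < 1"
  shows "\<exists>f\<in>eigenfuns. logof f = (\<lambda>g. (1 - t) * logof f1 g + t * logof f2 g) \<and>
    (1 - t) * H f1 x0 + t * H f2 x0 < H f x0"
proof -
  define \<alpha> where "\<alpha> = (\<lambda>g. (1 - t) * logof f1 g + t * logof f2 g)"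
  define \<mu> where "\<mu> = (1 - t) * H f1 x0 + t * H f2 x0"
  define h where "h x = exp ((1 - t) * ln (f1 x) + t * ln (f2 x))" for x
  have \<alpha>: "\<alpha> \<in> logchars"
    unfolding \<alpha>_def by (intro logchars_add logchars_scale logof_logchars f1 f2)
  obtain f l where f: "f x0 = 1" "\<And>x. 0 < f x" "equi \<alpha> f" "\<And>x. H f x = l * f x"
    using eigenfunction_exists[OF \<alpha>] by blast
  note fE = eigenfunsI[OF \<alpha> f]
  have p1: "0 < f1 x" and p2: "0 < f2 x" and H1: "H f1 x = H f1 x0 * f1 x"
    and H2: "H f2 x = H f2 x0 * f2 x" for x
    using eigenfunsD[OF f1] eigenfunsD[OF f2] by blast+
  have one: "f1 x0 = 1" "f2 x0 = 1" using eigenfunsD(1) f1 f2 by auto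
  have h_pos: "0 < h x" for x by (simp add: h_def)
  have h_equi: "equi \<alpha> h"
    unfolding equi_def
  proof (intro ballI allI)
    fix g x assume g: "g \<in> carrier G"
    have "ln (f1 (\<phi> g x)) = logof f1 g + ln (f1 x)" "ln (f2 (\<phi> g x)) = logof f2 g + ln (f2 x)"
      using equiD[OF equi_logof[OF f1] g] equiD[OF equi_logof[OF f2] g] p1[of x] p2[of x]
      by (auto simp: ln_mult)
    then show "h (\<phi> g x) = exp (\<alpha> g) * h x"
      by (simp add: h_def \<alpha>_def exp_add[symmetric] algebra_simps)
  qed
  \<comment> \<open>Ratios relative to the vertex \<open>x\<close> are averaged because the sum of
    these means over its neighbours is then given exactly by the two eigenvalue equations.\<close>
  define m where "m x y = (1 - t) * (f1 y / f1 x) + t * (f2 y / f2 x)" for x y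
  have ratio: "h y = h x * exp ((1 - t) * ln (f1 y / f1 x) + t * ln (f2 y / f2 x))" for x y
    using p1[of x] p1[of y] p2[of x] p2[of y]
    by (simp add: h_def exp_add[symmetric] ln_div algebra_simps)
  have am_gm: "h y \<le> h x * m x y" for x y
    unfolding ratio[of y x] m_def using p1 p2 t h_pos[of x]
    by (intro mult_left_mono weighted_am_gm(1)) (auto simp: less_imp_le)
  have am_gm_eq: "f1 y / f1 x = f2 y / f2 x" if "h y = h x * m x y" for x y
  proof (rule weighted_am_gm(2))
    show "exp ((1 - t) * ln (f1 y / f1 x) + t * ln (f2 y / f2 x)) = (1 - t) * (f1 y / f1 x) + t * (f2 y / f2 x)"
      using that h_pos[of x] unfolding ratio[of y x] m_def by simp
  qed (use p1 p2 t in auto)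
  have sum_m: "(\<Sum>y\<in>nb x. b x y * (h x * m x y)) = (diag x - \<mu>) * h x" for x
  proof -
    have s1: "(\<Sum>y\<in>nb x. b x y * f1 y) = (diag x - H f1 x0) * f1 x"
      and s2: "(\<Sum>y\<in>nb x. b x y * f2 y) = (diag x - H f2 x0) * f2 x"
      using H1[of x] H2[of x] H_eq[of f1 x] H_eq[of f2 x] by (auto simp: algebra_simps)
    have "(\<Sum>y\<in>nb x. b x y * (h x * m x y)) = (\<Sum>y\<in>nb x.
      h x * (1 - t) / f1 x * (b x y * f1 y) + h x * t / f2 x * (b x y * f2 y))"
      by (rule sum.cong) (auto simp: m_def algebra_simps)
    also have "\<dots> = h x * (1 - t) / f1 x * ((diag x - H f1 x0) * f1 x)
        + h x * t / f2 x * ((diag x - H f2 x0) * f2 x)"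
      unfolding sum.distrib sum_distrib_left[symmetric] s1 s2 ..
    also have "\<dots> = h x * (1 - t) * (diag x - H f1 x0) + h x * t * (diag x - H f2 x0)"
      using p1[of x] p2[of x] by simp
    finally show ?thesis by (simp add: \<mu>_def algebra_simps)
  qed
  have sup: "\<mu> * h x \<le> H h x" for x
  proof -
    have "(\<Sum>y\<in>nb x. b x y * h y) \<le> (\<Sum>y\<in>nb x. b x y * (h x * m x y))"
      by (intro sum_mono mult_left_mono am_gm b_nonneg)
    then show ?thesis unfolding sum_m by (simp add: H_eq algebra_simps)
  qed
  note max = eigenvalue_maximal[OF f(3,2,4) h_equi h_pos sup]
  \<comment> \<open>Otherwise the geometric mean is itself the eigenfunction and AM-GM is an
    equality on every edge. The ratios of \<open>f1\<close> and \<open>f2\<close> then agree along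
    edges, and both functions are 1 at \<open>x0\<close>.\<close>
  have "\<mu> \<noteq> l"
  proof
    assume eq: "\<mu> = l"
    then obtain k where k: "\<And>x. h x = k * f x" using max(2) by blast
    have hf: "h x = f x" for x using k[of x0] k[of x] f(1) one by (simp add: h_def)
    then have "h = f" by auto
    then have "H h x = \<mu> * h x" for x using f(4) eq by simp
    then have sum_eq: "(\<Sum>y\<in>nb x. b x y * (h x * m x y)) = (\<Sum>y\<in>nb x. b x y * h y)" for x
      unfolding sum_m using H_eq[of h x] by (simp add: algebra_simps)
    have edge: "f1 y / f1 x = f2 y / f2 x" if b: "0 < b x y" for x y
    proof -
      have "b x y * (h x * m x y) - b x y * h y = 0"
      proof (rule sum_nonneg_0[OF finite_nb])
        show "(\<Sum>y\<in>nb x. b x y * (h x * m x y) - b x y * h y) = 0"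
          unfolding sum_subtractf using sum_eq[of x] by simp
        show "0 \<le> b x y * (h x * m x y) - b x y * h y" for y
          using mult_left_mono[OF am_gm[of y x] b_nonneg[of x y]] by simp
        show "y \<in> nb x" using b by (simp add: nb_def)
      qed
      then show ?thesis using b by (intro am_gm_eq) (simp add: right_diff_distrib[symmetric])
    qed
    have "f1 x = f2 x" for x
    proof (rule path_induct[of "\<lambda>x. f1 x = f2 x" x0])
      show "f1 y = f2 y" if "f1 x = f2 x" "0 < b x y" for x y
        using edge[OF that(2)] that(1) p2[of x] by simp
    qed (use one in simp)
    then show False using \<open>f1 \<noteq> f2\<close> by auto
  qed
  then have "\<mu> < H f x0" using max(1) fE(3) by simp
  then show ?thesis using fE(1,2) unfolding \<mu>_def \<alpha>_def by blast
qed

text \<open>\<open>G\<close> is generated by the stabilizers together with the finitely many elements carrying the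
  fundamental domain to its neighbours, so finitely many values determine a logarithmic character.\<close>

lemma logchars_separated:
  "\<exists>F. finite F \<and> F \<subseteq> carrier G \<and> (\<forall>\<alpha>\<in>logchars. (\<forall>g\<in>F. \<alpha> g = 0) \<longrightarrow> \<alpha> = (\<lambda>_. 0))"
proof (intro exI conjI ballI impI)
  let ?F = "sec ` (V \<union> (\<Union>v\<in>V. nb v))"
  show "finite ?F" using V finite_nb by auto
  show "?F \<subseteq> carrier G" using rep_sec by auto
  fix \<alpha> assume \<alpha>: "\<alpha> \<in> logchars" and F: "\<forall>g\<in>?F. \<alpha> g = 0"
  have edge: "\<alpha> (sec y) = \<alpha> (sec x)" if b: "0 < b x y" for x y
  proof (cases "x = y")
    case False
    \<comment> \<open>Translated back, the edge starts in \<open>V\<close> and ends at a neighbour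
      of \<open>V\<close>, where \<open>\<alpha> \<circ> sec\<close> vanishes. The loop case is
      split off because \<open>b_act\<close> concerns distinct points.\<close>
    let ?g = "sec x" and ?y = "\<phi> (inv\<^bsub>G\<^esub> (sec x)) y"
    have g: "?g \<in> carrier G" by (rule rep_sec)
    have rx: "rep x = \<phi> (inv\<^bsub>G\<^esub> ?g) x" using act_inv(1)[OF g, of "rep x"] rep_sec(3)[of x] by simp
    have "0 < b (rep x) ?y" unfolding rx using b_act[OF G.inv_closed[OF g] False] b by simp
    then have "?y \<in> nb (rep x)" by (simp add: nb_def)
    then have "\<alpha> (sec ?y) = 0" using F rep_sec(1)[of x] by blast
    then show ?thesis using sec_act[OF \<alpha> g, of ?y] act_inv(2)[OF g, of y] by simp
  qed simp
  have const: "\<alpha> (sec x) = \<alpha> (sec x0)" for x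
    by (rule path_induct[of "\<lambda>x. \<alpha> (sec x) = \<alpha> (sec x0)" x0]) (use edge in auto)
  show "\<alpha> = (\<lambda>_. 0)"
  proof
    fix g
    show "\<alpha> g = 0"
    proof (cases "g \<in> carrier G")
      case True
      \<comment> \<open>\<open>\<alpha> \<circ> sec\<close> is constant, while acting by
        \<open>g\<close> shifts it by \<open>\<alpha> g\<close>.\<close>
      then show ?thesis using sec_act[OF \<alpha> True, of x0] const[of "\<phi> g x0"] by simp
    next
      case False
      then show ?thesis using \<alpha> by (simp add: logchars_def)
    qed
  qed
qed

lemma eigenfuns_level_sets:
  "\<exists>lam0 d. (\<forall>l>lam0. {f \<in> eigenfuns. H f x0 = l} = {}) \<and> (\<exists>f. {f \<in> eigenfuns. H f x0 = lam0} = {f}) \<and>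
    (\<forall>l<lam0. {f \<in> eigenfuns. H f x0 = l} homeomorphic sphere_d d) \<and>
    (\<forall>l::ereal. l < ereal lam0 \<longrightarrow>
      {f \<in> eigenfuns. l < ereal (H f x0) \<and> H f x0 \<le> lam0} homeomorphic ball_d d)"
proof -
  obtain F where F: "finite F" "F \<subseteq> carrier G"
    and sepF: "\<forall>\<alpha>\<in>logchars. (\<forall>g\<in>F. \<alpha> g = 0) \<longrightarrow> \<alpha> = (\<lambda>_. 0)"
    using logchars_separated by blast
  obtain d :: nat and e where e: "e ` {..<d} \<subseteq> F"
    and sep: "\<forall>\<alpha>\<in>logchars. (\<forall>i<d. \<alpha> (e i) = 0) \<longrightarrow> \<alpha> = (\<lambda>_. 0)"
    and surj: "\<forall>v. \<exists>\<alpha>\<in>logchars. \<forall>i<d. \<alpha> (e i) = v i"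
    using evaluation_coordinates[OF logchars_zero logchars_add logchars_scale F(1) sepF] by blast
  \<comment> \<open>The chart records the logarithmic character at the \<open>d\<close> chosen group
    elements; the zero padding matches the model spaces.\<close>
  define \<theta> where "\<theta> f i = (if i < d then logof f (e i) else 0)" for f i
  have exists: "\<exists>f\<in>eigenfuns. logof f = \<alpha>" if "\<alpha> \<in> logchars" for \<alpha>
    using eigenfunction_exists[OF that] eigenfunsI[OF that] by blast
  have "\<exists>lam0. (\<forall>l>lam0. {f \<in> eigenfuns. H f x0 = l} = {}) \<and> (\<exists>f. {f \<in> eigenfuns. H f x0 = lam0} = {f}) \<and>
    (\<forall>l<lam0. {f \<in> eigenfuns. H f x0 = l} homeomorphic sphere_d d) \<and>
    (\<forall>l::ereal. l < ereal lam0 \<longrightarrow>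
      {f \<in> eigenfuns. l < ereal (H f x0) \<and> H f x0 \<le> lam0} homeomorphic ball_d d)"
  proof (rule concave_level_sets[where \<theta> = \<theta>])
    show "eigenfuns \<noteq> {}" using exists[OF logchars_zero] by blast
    show "continuous_on eigenfuns (\<lambda>f. H f x0)" by (rule continuous_on_H)
    show "compact {f \<in> eigenfuns. r \<le> H f x0}" for r by (rule compact_eigenfuns_superlevel)
    show "continuous_on eigenfuns (\<lambda>f. \<theta> f i)" for i
    proof (cases "i < d")
      case True
      then have "e i \<in> carrier G" using e F by blast
      then have "(\<lambda>f. \<theta> f i) = (\<lambda>f. ln (f (\<phi> (e i) x0)))"
        using True by (simp add: \<theta>_def logof_def fun_eq_iff)
      moreover have "continuous_on eigenfuns (\<lambda>f. ln (f (\<phi> (e i) x0)))"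
      proof (intro continuous_on_ln ballI)
        show "continuous_on eigenfuns (\<lambda>f. f (\<phi> (e i) x0))"
          by (rule continuous_on_subset[OF continuous_on_product_coordinates]) simp
        show "f (\<phi> (e i) x0) \<noteq> 0" if "f \<in> eigenfuns" for f
          using eigenfunsD(2)[OF that, of "\<phi> (e i) x0"] by simp
      qed
      ultimately show ?thesis by (simp only:)
    next
      case False
      then show ?thesis by (simp add: \<theta>_def)
    qed
    show "bij_betw \<theta> eigenfuns {v. \<forall>i\<ge>d. v i = 0}"
      unfolding bij_betw_def
    proof (intro conjI equalityI subsetI)
      show "inj_on \<theta> eigenfuns"
      proof (rule inj_onI)
        fix f f' assume f: "f \<in> eigenfuns" "f' \<in> eigenfuns" and eq: "\<theta> f = \<theta> f'"
        have "(\<lambda>g. logof f g + (- 1) * logof f' g) \<in> logchars"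
          by (intro logchars_add logchars_scale logof_logchars f)
        moreover have "\<forall>i<d. logof f (e i) + (- 1) * logof f' (e i) = 0"
        proof (intro allI impI)
          show "logof f (e i) + (- 1) * logof f' (e i) = 0" if "i < d" for i
            using fun_cong[OF eq, of i] that by (simp add: \<theta>_def)
        qed
        ultimately have "(\<lambda>g. logof f g + (- 1) * logof f' g) = (\<lambda>_. 0)"
          by (rule sep[THEN bspec, THEN mp])
        then have "logof f = logof f'" by (simp add: fun_eq_iff)
        then show "f = f'" by (rule eigenfuns_eqI[OF f])
      qed
      fix v assume v: "v \<in> {v. \<forall>i\<ge>d. v i = (0::real)}"
      obtain \<alpha> where \<alpha>: "\<alpha> \<in> logchars" "\<forall>i<d. \<alpha> (e i) = v i" using surj by blast
      obtain f where f: "f \<in> eigenfuns" "logof f = \<alpha>" using exists[OF \<alpha>(1)] by blast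
      have "\<theta> f = v" using f \<alpha> v by (auto simp: \<theta>_def fun_eq_iff)
      then show "v \<in> \<theta> ` eigenfuns" using f by blast
    qed (auto simp: \<theta>_def)
    show "\<exists>h\<in>eigenfuns. (\<forall>i. \<theta> h i = (1 - t) * \<theta> f i + t * \<theta> f' i) \<and>
        (1 - t) * H f x0 + t * H f' x0 < H h x0"
      if asm: "f \<in> eigenfuns" "f' \<in> eigenfuns" "f \<noteq> f'" "0 < t" "t < 1" for f f' t
    proof -
      obtain h where "h \<in> eigenfuns" "logof h = (\<lambda>g. (1 - t) * logof f g + t * logof f' g)"
        "(1 - t) * H f x0 + t * H f' x0 < H h x0"
        using eigenvalue_strict_concave[OF asm] by blast
      then show ?thesis by (intro bexI[of _ h]) (simp_all add: \<theta>_def)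
    qed
  qed
  then show ?thesis by blast
qed

end

theorem theorem3:
  fixes b :: "'x::countable \<Rightarrow> 'x \<Rightarrow> real" and c :: "'x \<Rightarrow> real"
    and G :: "('g, 'm) monoid_scheme" and \<phi> :: "'g \<Rightarrow> 'x \<Rightarrow> 'x" and x0 :: 'x
  assumes "graph b" and "locally_finite b" and "connected_graph b"
    and "nilpotent_group G"
    and "group_action G UNIV \<phi>"
    and "cocompact G \<phi>"
    and "H_invariant G \<phi> b c"
  shows "\<exists>lam0::real. \<exists>d::nat.
     (\<forall>lam. lam > lam0 \<longrightarrow> Mset G \<phi> b c x0 {lam} = {}) \<and>
     (\<exists>f. Mset G \<phi> b c x0 {lam0} = {f}) \<and>
     (\<forall>lam. lam < lam0 \<longrightarrow> Mset G \<phi> b c x0 {lam} homeomorphic sphere_d d) \<and>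
     (\<forall>l::ereal. l < ereal lam0 \<longrightarrow>
        Mset G \<phi> b c x0 {mu. l < ereal mu \<and> mu \<le> lam0} homeomorphic ball_d d)"
proof -
  interpret cocompact_graph b c G \<phi> x0
    by (rule cocompact_graph.intro) fact+
  show ?thesis
    unfolding Mset_eq mem_Collect_eq singleton_iff by (rule eigenfuns_level_sets)
qed

end
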